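(* Let $(M,\omega,F)$ be a Finslerian symplectic manifold with $\dim M=2n$, and suppose that $F$ is locally Minkowskian. Let $(x^i)_{i=1}^{2n}$ denote natural coordinates for the locally Minkowskian manifold $M$ and let $(\hat x^i)_{i=1}^{2n}$ denote arbitrary local coordinates on $M$. Write $\partial_i=\partial/\partial x^i$, $\hat\partial_i=\partial/\partial\hat x^i$, $\omega_{ij}=\omega(\partial_i,\partial_j)$, $\hat\omega_{ij}=\omega(\hat\partial_i,\hat\partial_j)$. Then the Chern connection of $(M,F)$ preserves $\omega$ if and only if, for all such coordinate systems (the second identity being on the overlap of their domains) and all indices $i,j,k$, $$\partial_k\omega_{ij}=0,$$ $$\partial_h\hat x^l\;\hat\partial_k\hat\partial_i x^h\;\hat\omega_{lj}+\partial_h\hat x^l\;\hat\partial_k\hat\partial_j x^h\;\hat\omega_{il}=\hat\partial_k\hat\omega_{ij},$$ with summation over the repeated indices $h,l$.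
   Context: A symplectic manifold $(M,\omega)$ is a smooth manifold $M$ with a nondegenerate closed two-form $\omega$. A Minkowski norm on $\mathbb{R}^m$ is a function $\mathcal F:\mathbb{R}^m\to[0,\infty)$ that is $C^\infty$ on $\mathbb{R}^m\setminus\{0\}$, satisfies $\mathcal F(\lambda y)=\lambda\mathcal F(y)$ for all $\lambda>0$, and has positive-definite matrix $\left(\left[\tfrac12\mathcal F^2\right]_{y^iy^j}(y)\right)$ at all $y\ne0$. A Finsler structure on $M$ is a function $F:TM\to[0,\infty)$ that is $C^\infty$ on the slit tangent bundle $TM\setminus0$ and restricts to a Minkowski norm on each $T_xM$. A Finslerian symplectic manifold $(M,\omega,F)$ is a symplectic manifold $(M,\omega)$ together with a Finsler structure $F$ on $M$. $F$ is locally Minkowskian if around every point of $M$ there are local coordinates $(x^i)$ such that, in the induced coordinates $(x^i,y^i)$ on $TM$, $F$ depends only on $y$ and not on $x$; such coordinates are called natural coordinates. Let $\pi:TM\setminus 0\to M$ be the projection. In local coordinates $(x^i)$ on $M$ with induced coordinates $(x^i,y^i)$ on $TM$, put $g_{ij}=(\tfrac12F^2)_{y^iy^j}$, $A_{ijk}=\tfrac F2\,\partial g_{ij}/\partial y^k$, and $\frac{\delta y^i}{F}=\frac1F(dy^i+N^i_j\,dx^j)$, where the nonlinear connection is $N^i_j=\tfrac12\,\partial G^i/\partial y^j$ with $G^i=\gamma^i_{jk}y^jy^k$ and $\gamma^i_{jk}=\tfrac12g^{is}\left(\partial g_{sj}/\partial x^k-\partial g_{jk}/\partial x^s+\partial g_{ks}/\partial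 x^j\right)$. The Chern connection $\tilde\nabla$ is the unique linear connection on the pulled-back bundle $\pi^*TM$ whose connection forms $\theta^i_j$ satisfy $dx^j\wedge\theta^i_j=0$ and $dg_{ij}-g_{kj}\theta^k_i-g_{ik}\theta^k_j=2A_{ijs}\frac{\delta y^s}{F}$. Its forms are $\theta^k_j=\tilde\Gamma^k_{ij}\,dx^i$, with Christoffel symbols $\tilde\Gamma^k_{ij}=\tilde\Gamma^k_{ij}(x,y)=\tilde\Gamma^k_{ji}(x,y)$ on $TM\setminus0$, and one writes $\tilde\nabla_{\tilde\partial_i}\tilde\partial_j=\tilde\Gamma^k_{ij}\tilde\partial_k$. Canonical lifts: for a vector field $X$ on $M$, $\tilde X$ is the section of $\pi^*TM$ with $\tilde X_{(x,y)}=X_x$ (and $\tilde\partial_i$ is the lift of $\partial_i$); for the two-form $\omega$, $\tilde\omega_{(x,y)}(z_1,z_2)=\omega_x(z_1,z_2)$ for $x\in M$, $y\in T_xM\setminus0$, $z_1,z_2\in T_xM$. The Chern connection $\tilde\nabla$ preserves $\omega$ if for all $X,Y,Z\in\mathcal X(M)$, on $TM\setminus 0$, $\tilde Z(\tilde\omega(\tilde X,\tilde Y))=\tilde\omega(\tilde\nabla_{\tilde Z}\tilde X,\tilde Y)+\tilde\omega(\tilde X,\tilde\nabla_{\tilde Z}\tilde Y)$, where $\tilde Z(\tilde\omega(\tilde X,\tilde Y)):=Z(\omega(X,Y))$. In any local coordinates, with $\tilde\omega_{ij}=\tilde\omega(\tilde\partial_i,\tilde\partial_j)$, this says $\tilde\partial_k\tilde\omega_{ij}=\tilde\omega_{il}\tilde\Gamma^l_{kj}-\tilde\omega_{jl}\tilde\Gamma^l_{ki}$.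 *)

theory Defs
  imports "HOL-Analysis.Analysis"
begin

section \<open>Smooth functions on open subsets of normed spaces\<close>

definition dir_deriv ::
    "'a::real_normed_vector \<Rightarrow> ('a \<Rightarrow> 'b::real_normed_vector) \<Rightarrow> 'a \<Rightarrow> 'b" where
  "dir_deriv v f x = frechet_derivative f (at x) v"

text \<open>\<open>S\<close> is meant to be open and the source space finite-dimensional.\<close>

primrec Ck_on ::
    "nat \<Rightarrow> 'a::real_normed_vector set \<Rightarrow> ('a \<Rightarrow> 'b::real_normed_vector) \<Rightarrow> bool" where
  "Ck_on 0 S f \<longleftrightarrow> continuous_on S f"
| "Ck_on (Suc k) S f \<longleftrightarrow>
     (\<forall>x\<in>S. f differentiable (at x)) \<and> (\<forall>v. Ck_on k S (dir_deriv v f))"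

definition smooth_on ::
    "'a::real_normed_vector set \<Rightarrow> ('a \<Rightarrow> 'b::real_normed_vector) \<Rightarrow> bool" where
  "smooth_on S f \<longleftrightarrow> (\<forall>k. Ck_on k S f)"


section \<open>Charts, tangent vectors, vector fields\<close>

text \<open>
  A chart is a pair of a domain and a coordinate map; the values of the coordinate map outside
  the domain are irrelevant.  The notions of this section depend on an atlas \<open>B\<close> only and are
  used both for the manifold itself and for its slit tangent bundle.
\<close>

type_synonym ('p, 'e) chart = "'p set \<times> ('p \<Rightarrow> 'e)"

definition chart_inv :: "('p, 'e) chart \<Rightarrow> 'e \<Rightarrow> 'p" where
  "chart_inv C = inv_into (fst C) (snd C)"

definition coord_rep :: "('p, 'e) chart \<Rightarrow> ('p \<Rightarrow> 'b) \<Rightarrow> 'e \<Rightarrow> 'b" where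
  "coord_rep C f = f \<circ> chart_inv C"

definition compatible ::
    "('p, 'e::real_normed_vector) chart \<Rightarrow> ('p, 'e) chart \<Rightarrow> bool" where
  "compatible C C' \<longleftrightarrow>
     smooth_on (snd C ` (fst C \<inter> fst C')) (coord_rep C (snd C')) \<and>
     smooth_on (snd C' ` (fst C \<inter> fst C')) (coord_rep C' (snd C))"

text \<open>
  A tangent vector at \<open>p\<close> is the family of its component vectors in all charts around \<open>p\<close>,
  related by the Jacobians of the coordinate changes.  The family vanishes on everything that is
  not a chart around \<open>p\<close>, so that it is determined by its components in one chart.
\<close>

type_synonym ('p, 'e) tvec = "('p, 'e) chart \<Rightarrow> 'e"

definition tangent_space ::
    "('p, 'e::real_normed_vector) chart set \<Rightarrow> 'p \<Rightarrow> ('p, 'e) tvec set" where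
  "tangent_space B p =
     {v. (\<forall>C\<in>B. \<forall>C'\<in>B. p \<in> fst C \<inter> fst C' \<longrightarrow>
            v C' = dir_deriv (v C) (coord_rep C (snd C')) (snd C p)) \<and>
         (\<forall>C. \<not> (C \<in> B \<and> p \<in> fst C) \<longrightarrow> v C = 0)}"

definition tvec_of ::
    "('p, 'e::real_normed_vector) chart set \<Rightarrow> ('p, 'e) chart \<Rightarrow> 'p \<Rightarrow> 'e \<Rightarrow> ('p, 'e) tvec" where
  "tvec_of B C p y =
     (\<lambda>C'. if C' \<in> B \<and> p \<in> fst C' then dir_deriv y (coord_rep C (snd C')) (snd C p) else 0)"

definition manifold_open :: "('p, 'e::topological_space) chart set \<Rightarrow> 'p set \<Rightarrow> bool" where
  "manifold_open B W \<longleftrightarrow>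
     W \<subseteq> (\<Union>C\<in>B. fst C) \<and> (\<forall>C\<in>B. open (snd C ` (W \<inter> fst C)))"

definition smooth_fun ::
    "('p, 'e::real_normed_vector) chart set \<Rightarrow> 'p set \<Rightarrow> ('p \<Rightarrow> 'b::real_normed_vector) \<Rightarrow> bool"
  where
  "smooth_fun B W f \<longleftrightarrow> (\<forall>C\<in>B. smooth_on (snd C ` (W \<inter> fst C)) (coord_rep C f))"

definition vector_fields ::
    "('p, 'e::real_normed_vector) chart set \<Rightarrow> 'p set \<Rightarrow> ('p \<Rightarrow> ('p, 'e) tvec) set" where
  "vector_fields B W =
     {X. (\<forall>p\<in>W. X p \<in> tangent_space B p) \<and>
         (\<forall>C\<in>B. smooth_on (snd C ` (W \<inter> fst C)) (coord_rep C (\<lambda>p. X p C)))}"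

text \<open>The derivative \<open>v(f)\<close> does not depend on the chart in which it is computed.\<close>

definition vec_deriv ::
    "('p, 'e::real_normed_vector) chart set \<Rightarrow> 'p \<Rightarrow> ('p, 'e) tvec \<Rightarrow>
     ('p \<Rightarrow> 'b::real_normed_vector) \<Rightarrow> 'b" where
  "vec_deriv B p v f =
     (let C = (SOME C. C \<in> B \<and> p \<in> fst C) in dir_deriv (v C) (coord_rep C f) (snd C p))"


section \<open>Smooth manifolds and two-forms\<close>

text \<open>
  The manifold is the whole type \<open>'m\<close>; its smooth structure is a maximal atlas, whose members are
  the local coordinate systems.
\<close>

definition topological_chart ::
    "('m::topological_space, real^'d) chart \<Rightarrow> bool" where
  "topological_chart c \<longleftrightarrow>
     open (fst c) \<and> open (snd c ` fst c) \<and>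
     homeomorphism (fst c) (snd c ` fst c) (snd c) (chart_inv c)"

definition smooth_structure ::
    "('m::{t2_space, second_countable_topology}, real^'d) chart set \<Rightarrow> bool" where
  "smooth_structure A \<longleftrightarrow>
     (\<forall>c\<in>A. topological_chart c) \<and>
     (\<Union>c\<in>A. fst c) = UNIV \<and>
     (\<forall>c\<in>A. \<forall>c'\<in>A. compatible c c') \<and>
     (\<forall>c. topological_chart c \<and> (\<forall>c'\<in>A. compatible c c') \<longrightarrow> c \<in> A)"

definition coord_field ::
    "('m, real^'d) chart set \<Rightarrow> ('m, real^'d) chart \<Rightarrow> 'd \<Rightarrow> 'm \<Rightarrow> ('m, real^'d) tvec" where
  "coord_field A c i p = tvec_of A c p (axis i 1)"

definition coord_deriv ::
    "('m, real^'d) chart \<Rightarrow> 'd \<Rightarrow> ('m \<Rightarrow> real) \<Rightarrow> 'm \<Rightarrow> real" where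
  "coord_deriv c i f p = dir_deriv (axis i 1) (coord_rep c f) (snd c p)"

type_synonym ('m, 'e) bilin_field = "'m \<Rightarrow> ('m, 'e) tvec \<Rightarrow> ('m, 'e) tvec \<Rightarrow> real"

definition form_comp ::
    "('m, real^'d) chart set \<Rightarrow> ('m, real^'d) bilin_field \<Rightarrow> ('m, real^'d) chart \<Rightarrow>
     'd \<Rightarrow> 'd \<Rightarrow> 'm \<Rightarrow> real" where
  "form_comp A \<omega> c i j p = \<omega> p (coord_field A c i p) (coord_field A c j p)"

definition two_form ::
    "('m, real^'d) chart set \<Rightarrow> ('m, real^'d) bilin_field \<Rightarrow> bool" where
  "two_form A \<omega> \<longleftrightarrow>
     (\<forall>p. \<forall>u\<in>tangent_space A p. \<forall>v\<in>tangent_space A p. \<forall>w\<in>tangent_space A p. \<forall>a b.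
        \<omega> p (\<lambda>c. a *\<^sub>R u c + b *\<^sub>R v c) w = a * \<omega> p u w + b * \<omega> p v w) \<and>
     (\<forall>p. \<forall>u\<in>tangent_space A p. \<forall>v\<in>tangent_space A p. \<omega> p u v = - \<omega> p v u) \<and>
     (\<forall>c\<in>A. \<forall>i j. smooth_on (snd c ` fst c) (coord_rep c (form_comp A \<omega> c i j)))"

text \<open>\<open>(d\<omega>)\<^sub>i\<^sub>j\<^sub>k = \<partial>\<^sub>i \<omega>\<^sub>j\<^sub>k + \<partial>\<^sub>j \<omega>\<^sub>k\<^sub>i + \<partial>\<^sub>k \<omega>\<^sub>i\<^sub>j\<close>\<close>

definition closed_form ::
    "('m, real^'d) chart set \<Rightarrow> ('m, real^'d) bilin_field \<Rightarrow> bool" where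
  "closed_form A \<omega> \<longleftrightarrow>
     (\<forall>c\<in>A. \<forall>p\<in>fst c. \<forall>i j k.
        coord_deriv c i (form_comp A \<omega> c j k) p + coord_deriv c j (form_comp A \<omega> c k i) p
        + coord_deriv c k (form_comp A \<omega> c i j) p = 0)"

definition nondegenerate_form ::
    "('m, real^'d) chart set \<Rightarrow> ('m, real^'d) bilin_field \<Rightarrow> bool" where
  "nondegenerate_form A \<omega> \<longleftrightarrow>
     (\<forall>p. \<forall>v\<in>tangent_space A p. (\<forall>w\<in>tangent_space A p. \<omega> p v w = 0) \<longrightarrow> v = (\<lambda>_. 0))"

definition symplectic_form ::
    "('m, real^'d) chart set \<Rightarrow> ('m, real^'d) bilin_field \<Rightarrow> bool" where
  "symplectic_form A \<omega> \<longleftrightarrow> two_form A \<omega> \<and> closed_form A \<omega> \<and> nondegenerate_form A \<omega>"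


section \<open>Finsler structures\<close>

definition minkowski_norm :: "(real^'d \<Rightarrow> real) \<Rightarrow> bool" where
  "minkowski_norm \<Phi> \<longleftrightarrow>
     (\<forall>y. 0 \<le> \<Phi> y) \<and>
     smooth_on (- {0}) \<Phi> \<and>
     (\<forall>a>0. \<forall>y. \<Phi> (a *\<^sub>R y) = a * \<Phi> y) \<and>
     (\<forall>y. y \<noteq> 0 \<longrightarrow> (\<forall>w. w \<noteq> 0 \<longrightarrow>
        0 < (\<Sum>i\<in>UNIV. \<Sum>j\<in>UNIV.
               dir_deriv (axis j 1) (dir_deriv (axis i 1) (\<lambda>y. (\<Phi> y)\<^sup>2 / 2)) y * w $ i * w $ j)))"

definition slit_bundle ::
    "('m, 'e::real_normed_vector) chart set \<Rightarrow> ('m \<times> ('m, 'e) tvec) set" where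
  "slit_bundle A = {(p, v). v \<in> tangent_space A p \<and> v \<noteq> (\<lambda>_. 0)}"

text \<open>Induced coordinates \<open>(x, y)\<close> on the slit tangent bundle.\<close>

definition slit_chart ::
    "('m, 'e::real_normed_vector) chart set \<Rightarrow> ('m, 'e) chart \<Rightarrow>
     ('m \<times> ('m, 'e) tvec, 'e \<times> 'e) chart" where
  "slit_chart A c = ({(p, v) \<in> slit_bundle A. p \<in> fst c}, \<lambda>(p, v). (snd c p, v c))"

definition slit_atlas ::
    "('m, 'e::real_normed_vector) chart set \<Rightarrow> ('m \<times> ('m, 'e) tvec, 'e \<times> 'e) chart set" where
  "slit_atlas A = slit_chart A ` A"

definition finsler_structure ::
    "('m, real^'d) chart set \<Rightarrow> ('m \<times> ('m, real^'d) tvec \<Rightarrow> real) \<Rightarrow> bool" where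
  "finsler_structure A F \<longleftrightarrow>
     smooth_fun (slit_atlas A) (slit_bundle A) F \<and>
     (\<forall>c\<in>A. \<forall>p\<in>fst c. minkowski_norm (\<lambda>y. F (p, tvec_of A c p y)))"

definition natural_coordinates ::
    "('m, real^'d) chart set \<Rightarrow> ('m \<times> ('m, real^'d) tvec \<Rightarrow> real) \<Rightarrow>
     ('m, real^'d) chart \<Rightarrow> bool" where
  "natural_coordinates A F c \<longleftrightarrow>
     c \<in> A \<and> (\<exists>\<Phi>. \<forall>p\<in>fst c. \<forall>v\<in>tangent_space A p. F (p, v) = \<Phi> (v c))"

definition locally_minkowskian ::
    "('m, real^'d) chart set \<Rightarrow> ('m \<times> ('m, real^'d) tvec \<Rightarrow> real) \<Rightarrow> bool" where
  "locally_minkowskian A F \<longleftrightarrow> (\<forall>p. \<exists>c. natural_coordinates A F c \<and> p \<in> fst c)"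


section \<open>Local Finsler quantities\<close>

text \<open>
  Here \<open>L\<close> is the expression \<open>L (x, y)\<close> of a Finsler structure in induced coordinates, and all
  quantities are functions of \<open>z = (x, y)\<close>.
\<close>

definition partial_x ::
    "'d \<Rightarrow> ((real^'d) \<times> (real^'d) \<Rightarrow> real) \<Rightarrow> (real^'d) \<times> (real^'d) \<Rightarrow> real" where
  "partial_x i = dir_deriv (axis i 1, 0)"

definition partial_y ::
    "'d \<Rightarrow> ((real^'d) \<times> (real^'d) \<Rightarrow> real) \<Rightarrow> (real^'d) \<times> (real^'d) \<Rightarrow> real" where
  "partial_y i = dir_deriv (0, axis i 1)"

definition fund_tensor ::
    "((real^'d) \<times> (real^'d) \<Rightarrow> real) \<Rightarrow> 'd \<Rightarrow> 'd \<Rightarrow> (real^'d) \<times> (real^'d) \<Rightarrow> real" where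
  "fund_tensor L i j = partial_y j (partial_y i (\<lambda>z. (L z)\<^sup>2 / 2))"

definition fund_tensor_inv ::
    "((real^'d) \<times> (real^'d) \<Rightarrow> real) \<Rightarrow> 'd \<Rightarrow> 'd \<Rightarrow> (real^'d) \<times> (real^'d) \<Rightarrow> real" where
  "fund_tensor_inv L i j z = matrix_inv (\<chi> k l. fund_tensor L k l z) $ i $ j"

definition cartan_tensor ::
    "((real^'d) \<times> (real^'d) \<Rightarrow> real) \<Rightarrow> 'd \<Rightarrow> 'd \<Rightarrow> 'd \<Rightarrow> (real^'d) \<times> (real^'d) \<Rightarrow> real"
  where
  "cartan_tensor L i j k z = L z / 2 * partial_y k (fund_tensor L i j) z"

text \<open>\<open>formal_christoffel L i j k\<close> is \<open>\<gamma>\<^sup>i\<^sub>j\<^sub>k\<close>.\<close>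

definition formal_christoffel ::
    "((real^'d) \<times> (real^'d) \<Rightarrow> real) \<Rightarrow> 'd \<Rightarrow> 'd \<Rightarrow> 'd \<Rightarrow> (real^'d) \<times> (real^'d) \<Rightarrow> real"
  where
  "formal_christoffel L i j k z =
     (1 / 2) * (\<Sum>s\<in>UNIV. fund_tensor_inv L i s z *
       (partial_x k (fund_tensor L s j) z - partial_x s (fund_tensor L j k) z
        + partial_x j (fund_tensor L k s) z))"

definition spray ::
    "((real^'d) \<times> (real^'d) \<Rightarrow> real) \<Rightarrow> 'd \<Rightarrow> (real^'d) \<times> (real^'d) \<Rightarrow> real" where
  "spray L i z =
     (\<Sum>j\<in>UNIV. \<Sum>k\<in>UNIV. formal_christoffel L i j k z * (snd z $ j) * (snd z $ k))"

definition nonlinear_connection ::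
    "((real^'d) \<times> (real^'d) \<Rightarrow> real) \<Rightarrow> 'd \<Rightarrow> 'd \<Rightarrow> (real^'d) \<times> (real^'d) \<Rightarrow> real" where
  "nonlinear_connection L i j z = (1 / 2) * partial_y j (spray L i) z"

text \<open>The one-form \<open>\<delta>y\<^sup>i / F\<close> at \<open>z\<close>, evaluated on \<open>\<zeta> = (dx, dy)\<close>.\<close>

definition delta_y_over_F ::
    "((real^'d) \<times> (real^'d) \<Rightarrow> real) \<Rightarrow> 'd \<Rightarrow> (real^'d) \<times> (real^'d) \<Rightarrow>
     (real^'d) \<times> (real^'d) \<Rightarrow> real" where
  "delta_y_over_F L i z \<zeta> =
     (1 / L z) * (snd \<zeta> $ i + (\<Sum>j\<in>UNIV. nonlinear_connection L i j z * (fst \<zeta> $ j)))"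


section \<open>Linear connections on the pulled-back bundle\<close>

type_synonym ('m, 'e) slit_tvec = "('m \<times> ('m, 'e) tvec, 'e \<times> 'e) tvec"

type_synonym ('m, 'e) pb_section = "'m \<times> ('m, 'e) tvec \<Rightarrow> ('m, 'e) tvec"

text \<open>Smooth sections of \<open>\<pi>\<^sup>*TM\<close> over an open subset \<open>W\<close> of the slit tangent bundle.\<close>

definition pb_sections ::
    "('m, 'e::real_normed_vector) chart set \<Rightarrow> ('m \<times> ('m, 'e) tvec) set \<Rightarrow>
     ('m, 'e) pb_section set" where
  "pb_sections A W =
     {s. (\<forall>\<xi>\<in>W. s \<xi> \<in> tangent_space A (fst \<xi>)) \<and>
         (\<forall>c\<in>A. smooth_on (snd (slit_chart A c) ` (W \<inter> fst (slit_chart A c)))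
                   (coord_rep (slit_chart A c) (\<lambda>\<xi>. s \<xi> c)))}"

text \<open>
  \<open>nabla \<xi> \<zeta> s\<close> is the covariant derivative of the local section \<open>s\<close> in the direction of
  the tangent vector \<open>\<zeta>\<close> of the slit tangent bundle at \<open>\<xi>\<close>.  Local sections
  are needed for the connection forms, which are taken with respect to coordinate frames.
  Locality follows from the Leibniz rule, applied on a smaller open set to its indicator function.
\<close>

type_synonym ('m, 'e) pb_connection =
  "'m \<times> ('m, 'e) tvec \<Rightarrow> ('m, 'e) slit_tvec \<Rightarrow> ('m, 'e) pb_section \<Rightarrow> ('m, 'e) tvec"

definition linear_connection ::
    "('m, 'e::real_normed_vector) chart set \<Rightarrow> ('m, 'e) pb_connection \<Rightarrow> bool" where
  "linear_connection A nabla \<longleftrightarrow>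
     (\<forall>W. manifold_open (slit_atlas A) W \<longrightarrow> (\<forall>s\<in>pb_sections A W.
        (\<forall>\<xi>\<in>W. \<forall>\<zeta>\<in>tangent_space (slit_atlas A) \<xi>.
           nabla \<xi> \<zeta> s \<in> tangent_space A (fst \<xi>) \<and>
           (\<forall>\<zeta>'\<in>tangent_space (slit_atlas A) \<xi>. \<forall>a b.
              nabla \<xi> (\<lambda>C. a *\<^sub>R \<zeta> C + b *\<^sub>R \<zeta>' C) s
              = (\<lambda>c. a *\<^sub>R nabla \<xi> \<zeta> s c + b *\<^sub>R nabla \<xi> \<zeta>' s c)) \<and>
           (\<forall>t\<in>pb_sections A W.
              nabla \<xi> \<zeta> (\<lambda>\<eta> c. s \<eta> c + t \<eta> c)
              = (\<lambda>c. nabla \<xi> \<zeta> s c + nabla \<xi> \<zeta> t c)) \<and>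
           (\<forall>f :: 'm \<times> ('m, 'e) tvec \<Rightarrow> real. smooth_fun (slit_atlas A) W f \<longrightarrow>
              nabla \<xi> \<zeta> (\<lambda>\<eta> c. f \<eta> *\<^sub>R s \<eta> c)
              = (\<lambda>c. vec_deriv (slit_atlas A) \<xi> \<zeta> f *\<^sub>R s \<xi> c
                      + f \<xi> *\<^sub>R nabla \<xi> \<zeta> s c))) \<and>
        (\<forall>Z\<in>vector_fields (slit_atlas A) W. (\<lambda>\<xi>. nabla \<xi> (Z \<xi>) s) \<in> pb_sections A W)))"

definition lift_field :: "('m \<Rightarrow> ('m, 'e) tvec) \<Rightarrow> ('m, 'e) pb_section" where
  "lift_field X = (\<lambda>\<xi>. X (fst \<xi>))"

definition lift_form ::
    "('m, 'e) bilin_field \<Rightarrow> 'm \<times> ('m, 'e) tvec \<Rightarrow> ('m, 'e) tvec \<Rightarrow> ('m, 'e) tvec \<Rightarrow> real"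
  where
  "lift_form \<omega> = (\<lambda>\<xi>. \<omega> (fst \<xi>))"

text \<open>
  \<open>connection_form A nabla c i j\<close> is \<open>\<theta>\<^sup>i\<^sub>j\<close>, defined by
  \<open>\<nabla>\<^sub>\<zeta> \<partial>\<^sub>j = \<theta>\<^sup>i\<^sub>j(\<zeta>) \<partial>\<^sub>i\<close>.
\<close>

definition connection_form ::
    "('m, real^'d) chart set \<Rightarrow> ('m, real^'d) pb_connection \<Rightarrow> ('m, real^'d) chart \<Rightarrow>
     'd \<Rightarrow> 'd \<Rightarrow> 'm \<times> ('m, real^'d) tvec \<Rightarrow> ('m, real^'d) slit_tvec \<Rightarrow> real" where
  "connection_form A nabla c i j \<xi> \<zeta> = nabla \<xi> \<zeta> (lift_field (coord_field A c j)) c $ i"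

text \<open>
  The two conditions are \<open>dx\<^sup>j \<and> \<theta>\<^sup>i\<^sub>j = 0\<close> and
  \<open>dg\<^sub>i\<^sub>j - g\<^sub>k\<^sub>j \<theta>\<^sup>k\<^sub>i - g\<^sub>i\<^sub>k \<theta>\<^sup>k\<^sub>j = 2 A\<^sub>i\<^sub>j\<^sub>s \<delta>y\<^sup>s / F\<close>,
  evaluated on tangent vectors of the slit tangent bundle; they determine \<open>nabla\<close> uniquely.
\<close>

definition chern_connection ::
    "('m, real^'d) chart set \<Rightarrow> ('m \<times> ('m, real^'d) tvec \<Rightarrow> real) \<Rightarrow>
     ('m, real^'d) pb_connection \<Rightarrow> bool" where
  "chern_connection A F nabla \<longleftrightarrow>
     linear_connection A nabla \<and>
     (\<forall>c\<in>A. \<forall>\<xi>\<in>fst (slit_chart A c).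
        let C = slit_chart A c; L = coord_rep C F; z = snd C \<xi>;
            \<theta> = (\<lambda>i j. connection_form A nabla c i j \<xi>)
        in
          (\<forall>\<zeta>\<in>tangent_space (slit_atlas A) \<xi>. \<forall>\<zeta>'\<in>tangent_space (slit_atlas A) \<xi>. \<forall>i.
             (\<Sum>j\<in>UNIV. fst (\<zeta> C) $ j * \<theta> i j \<zeta>' - fst (\<zeta>' C) $ j * \<theta> i j \<zeta>) = 0) \<and>
          (\<forall>\<zeta>\<in>tangent_space (slit_atlas A) \<xi>. \<forall>i j.
             dir_deriv (\<zeta> C) (fund_tensor L i j) z
             - (\<Sum>k\<in>UNIV. fund_tensor L k j z * \<theta> k i \<zeta>)
             - (\<Sum>k\<in>UNIV. fund_tensor L i k z * \<theta> k j \<zeta>)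
             = 2 * (\<Sum>s\<in>UNIV. cartan_tensor L i j s z * delta_y_over_F L s z (\<zeta> C))))"

definition d_proj ::
    "('m, 'e::real_normed_vector) chart set \<Rightarrow> 'm \<times> ('m, 'e) tvec \<Rightarrow> ('m, 'e) slit_tvec \<Rightarrow>
     ('m, 'e) tvec" where
  "d_proj A \<xi> \<zeta> =
     (\<lambda>c. if c \<in> A \<and> fst \<xi> \<in> fst c then fst (\<zeta> (slit_chart A c)) else 0)"

text \<open>
  The connection forms of a Chern connection contain only \<open>dx\<^sup>i\<close>, so on lifted vector fields
  the derivative in direction \<open>\<zeta>\<close> depends only on the projection of \<open>\<zeta>\<close> to the base.  Hence
  the derivative of the lift of \<open>X\<close> in the direction of the lift of \<open>Z\<close> is
  \<open>nabla \<xi> \<zeta> (lift_field X)\<close> for any \<open>\<zeta>\<close> over \<open>Z\<close>; such \<open>\<zeta>\<close> always exist.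
\<close>

definition preserves_form ::
    "('m, real^'d) chart set \<Rightarrow> ('m, real^'d) pb_connection \<Rightarrow> ('m, real^'d) bilin_field \<Rightarrow> bool"
  where
  "preserves_form A nabla \<omega> \<longleftrightarrow>
     (\<forall>X\<in>vector_fields A UNIV. \<forall>Y\<in>vector_fields A UNIV. \<forall>Z\<in>vector_fields A UNIV.
      \<forall>\<xi>\<in>slit_bundle A. \<forall>\<zeta>\<in>tangent_space (slit_atlas A) \<xi>.
        d_proj A \<xi> \<zeta> = Z (fst \<xi>) \<longrightarrow>
        vec_deriv A (fst \<xi>) (Z (fst \<xi>)) (\<lambda>p. \<omega> p (X p) (Y p))
        = lift_form \<omega> \<xi> (nabla \<xi> \<zeta> (lift_field X)) (lift_field Y \<xi>)
          + lift_form \<omega> \<xi> (lift_field X \<xi>) (nabla \<xi> \<zeta> (lift_field Y)))"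

end

theory Submission
  imports Defs
begin

text \<open>
  In natural coordinates the Finsler structure is a single Minkowski norm \<open>\<Phi>(y)\<close>.  Its fundamental
  tensor does not depend on \<open>x\<close>, so the formal Christoffel symbols, the spray and the nonlinear
  connection vanish, and the right-hand side of the second structure equation of the Chern connection
  equals the differential of the fundamental tensor.  What remains is that the connection forms are
  torsion-free and skew with respect to a positive-definite form, and this forces them to vanish
  (\<open>torsion_free_metric_zero\<close>, \<open>chern_form_natural_zero\<close>).

  Hence, by the Leibniz rule and locality, the Chern connection differentiates lifted vector fields
  componentwise in natural coordinates (\<open>chern_derivative_natural\<close>).  The product rule for
  \<open>\<omega>(X, Y) = \<Sum> X\<^sup>i Y\<^sup>j \<omega>\<^sub>i\<^sub>j\<close> then shows that the failure to preserve \<open>\<omega>\<close> is the tensorial expression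
  \<open>\<Sum> Z\<^sup>k X\<^sup>i Y\<^sup>j \<partial>\<^sub>k \<omega>\<^sub>i\<^sub>j\<close> (\<open>preservation_defect\<close>).  Bump functions provide global vector fields with
  arbitrary values at a point, and natural coordinates exist around every point, so \<open>\<omega>\<close> is preserved
  exactly when its components are constant in all natural coordinates
  (\<open>preserves_form_iff_constant\<close>).

  The identity in arbitrary coordinates is a consequence of this constancy: it is the derivative of
  the transformation law of the components of \<open>\<omega>\<close> (\<open>constant_form_change\<close>).
\<close>


section \<open>Directional derivatives\<close>

lemma dir_deriv_eq:
  "(f has_derivative f') (at x) \<Longrightarrow> dir_deriv v f x = f' v"
  unfolding dir_deriv_def by (metis frechet_derivative_at)

lemma has_derivative_dir_deriv:
  "f differentiable at x \<Longrightarrow> (f has_derivative (\<lambda>v. dir_deriv v f x)) (at x)"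
  unfolding dir_deriv_def using frechet_derivative_works by auto

lemma dir_deriv_cong:
  assumes "open S" "x \<in> S" "\<And>y. y \<in> S \<Longrightarrow> f y = g y"
  shows "dir_deriv v f x = dir_deriv v g x"
proof -
  have "(f has_derivative D) (at x) \<longleftrightarrow> (g has_derivative D) (at x)" for D
    using has_derivative_transform_within_open[OF _ assms(1,2), of f D UNIV g]
      has_derivative_transform_within_open[OF _ assms(1,2), of g D UNIV f] assms(3) by auto
  then show ?thesis by (simp add: dir_deriv_def frechet_derivative_def)
qed

lemma differentiable_cong:
  assumes "open S" "x \<in> S" "\<And>y. y \<in> S \<Longrightarrow> f y = g y" "f differentiable at x"
  shows "g differentiable at x"
  using assms has_derivative_transform_within_open[OF _ assms(1,2), of f _ UNIV g]
  unfolding differentiable_def by blast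

lemma dir_deriv_linear:
  assumes "f differentiable at x"
  shows "bounded_linear (\<lambda>v. dir_deriv v f x)"
  using has_derivative_bounded_linear[OF has_derivative_dir_deriv[OF assms]] .

lemma dir_deriv_compose:
  assumes "f differentiable at x" "g differentiable at (f x)"
  shows "dir_deriv v (g \<circ> f) x = dir_deriv (dir_deriv v f x) g (f x)"
  using dir_deriv_eq[OF diff_chain_at[OF has_derivative_dir_deriv[OF assms(1)]
        has_derivative_dir_deriv[OF assms(2)]]] by simp

lemma dir_deriv_of_linear:
  assumes "bounded_linear \<pi>" "open S" "z \<in> S" "\<And>z. z \<in> S \<Longrightarrow> f z = h (\<pi> z)" "h differentiable at (\<pi> z)"
  shows "dir_deriv w f z = dir_deriv (\<pi> w) h (\<pi> z)"
proof -
  have "dir_deriv w f z = dir_deriv w (h \<circ> \<pi>) z"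
    by (rule dir_deriv_cong[OF assms(2,3)]) (simp add: assms(4))
  also have "\<dots> = dir_deriv (dir_deriv w \<pi> z) h (\<pi> z)"
    by (rule dir_deriv_compose[OF bounded_linear_imp_differentiable[OF assms(1)] assms(5)])
  finally show ?thesis
    by (simp add: dir_deriv_eq[OF bounded_linear_imp_has_derivative[OF assms(1)]])
qed

lemma dir_deriv_basis:
  fixes f :: "'a::euclidean_space \<Rightarrow> 'b::real_normed_vector"
  assumes "f differentiable at x"
  shows "dir_deriv v f x = (\<Sum>b\<in>Basis. (v \<bullet> b) *\<^sub>R dir_deriv b f x)"
proof -
  interpret bounded_linear "\<lambda>v. dir_deriv v f x" by (rule dir_deriv_linear[OF assms])
  have "dir_deriv v f x = dir_deriv (\<Sum>b\<in>Basis. (v \<bullet> b) *\<^sub>R b) f x" by (simp add: euclidean_representation)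
  also have "\<dots> = (\<Sum>b\<in>Basis. (v \<bullet> b) *\<^sub>R dir_deriv b f x)" by (simp add: sum scaleR)
  finally show ?thesis .
qed

lemma sum_axis_vec: "(\<Sum>i\<in>UNIV. (v $ i) *\<^sub>R axis i 1) = (v :: real^'d)"
  using basis_expansion[of v] by (simp add: scalar_mult_eq_scaleR)

lemma dir_deriv_axes:
  fixes f :: "real^'d \<Rightarrow> 'b::real_normed_vector"
  assumes "f differentiable at x"
  shows "dir_deriv v f x = (\<Sum>i\<in>UNIV. (v $ i) *\<^sub>R dir_deriv (axis i 1) f x)"
proof -
  interpret bounded_linear "\<lambda>v. dir_deriv v f x" by (rule dir_deriv_linear[OF assms])
  have "dir_deriv v f x = dir_deriv (\<Sum>i\<in>UNIV. (v $ i) *\<^sub>R axis i 1) f x" by (simp add: sum_axis_vec)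
  also have "\<dots> = (\<Sum>i\<in>UNIV. (v $ i) *\<^sub>R dir_deriv (axis i 1) f x)" by (simp add: sum scaleR)
  finally show ?thesis .
qed

lemma dir_deriv_vec_nth:
  assumes "f differentiable at x"
  shows "dir_deriv v (\<lambda>x. f x $ i) x = dir_deriv v f x $ i"
  using dir_deriv_eq[OF bounded_linear.has_derivative[OF bounded_linear_vec_nth
        has_derivative_dir_deriv[OF assms]]] .

lemma dir_deriv_const [simp]: "dir_deriv v (\<lambda>x. c) x = 0"
  by (rule dir_deriv_eq) simp

section \<open>Stability of smoothness\<close>

lemma Ck_on_cong:
  assumes "open S" "\<And>x. x \<in> S \<Longrightarrow> f x = g x"
  shows "Ck_on k S f \<longleftrightarrow> Ck_on k S g"
  using assms(2)
proof (induction k arbitrary: f g)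
  case 0
  then show ?case by (simp cong: continuous_on_cong)
next
  case (Suc k)
  have "Ck_on k S (dir_deriv v f) \<longleftrightarrow> Ck_on k S (dir_deriv v g)" for v
    by (rule Suc.IH) (rule dir_deriv_cong[OF assms(1)], auto simp: Suc.prems)
  moreover have "f differentiable at x \<longleftrightarrow> g differentiable at x" if "x \<in> S" for x
    using differentiable_cong[OF assms(1) that] Suc.prems by metis
  ultimately show ?case by simp
qed

lemma Ck_on_subset: "Ck_on k S f \<Longrightarrow> T \<subseteq> S \<Longrightarrow> Ck_on k T f"
  by (induction k arbitrary: f) (auto intro: continuous_on_subset)

lemma Ck_on_continuous: "Ck_on k S f \<Longrightarrow> continuous_on S f"
  by (cases k) (auto intro!: continuous_at_imp_continuous_on differentiable_imp_continuous_within)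

lemma Ck_on_lower: "Ck_on (Suc k) S f \<Longrightarrow> Ck_on k S f"
proof (induction k arbitrary: f)
  case 0
  then show ?case using Ck_on_continuous by fastforce
qed auto

lemma Ck_on_Un:
  assumes "open S" "open T" "Ck_on k S f" "Ck_on k T f"
  shows "Ck_on k (S \<union> T) f"
  using assms(3,4) by (induction k arbitrary: f) (auto intro: continuous_on_open_Un assms)

lemma Ck_on_const [intro]: "Ck_on k S (\<lambda>x. c)"
proof (induction k arbitrary: c)
  case (Suc k)
  have "dir_deriv v (\<lambda>x::'a. c) = (\<lambda>x. 0)" for v by (simp add: fun_eq_iff)
  then show ?case using Suc by simp
qed auto

lemma Ck_on_bounded_linear:
  assumes "bounded_linear h" shows "Ck_on k S h"
proof (cases k)
  case 0
  then show ?thesis using bounded_linear.continuous_on[OF assms, of S "\<lambda>x. x"] by simp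
next
  case (Suc k')
  have "dir_deriv v h = (\<lambda>x. h v)" for v
    using dir_deriv_eq[OF bounded_linear_imp_has_derivative[OF assms]] by auto
  then show ?thesis using Suc bounded_linear_imp_differentiable[OF assms] by auto
qed

text \<open>
  Inductions over the order of differentiability are easiest when all directional derivatives
  are given at once, as functions that are known only on \<open>S\<close>.
\<close>

lemma Ck_on_SucI:
  assumes "open S" "\<And>x. x \<in> S \<Longrightarrow> (f has_derivative (\<lambda>v. D v x)) (at x)" "\<And>v. Ck_on k S (D v)"
  shows "Ck_on (Suc k) S f"
proof -
  have "Ck_on k S (dir_deriv v f)" for v
    using Ck_on_cong[OF assms(1), of "dir_deriv v f" "D v" k] dir_deriv_eq[OF assms(2)] assms(3) by auto
  then show ?thesis using assms(2) by (auto simp: differentiable_def)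
qed

lemma Ck_on_linear_image:
  assumes "bounded_linear h" "open S" "Ck_on k S f"
  shows "Ck_on k S (\<lambda>x. h (f x))"
  using assms(3)
proof (induction k arbitrary: f)
  case 0
  then show ?case using bounded_linear.continuous_on[OF assms(1)] by simp
next
  case (Suc k)
  show ?case
  proof (rule Ck_on_SucI[OF assms(2)])
    show "((\<lambda>x. h (f x)) has_derivative (\<lambda>v. h (dir_deriv v f x))) (at x)" if "x \<in> S" for x
      using Suc.prems that
      by (intro bounded_linear.has_derivative[OF assms(1)] has_derivative_dir_deriv) auto
    show "Ck_on k S (\<lambda>x. h (dir_deriv v f x))" for v
      by (rule Suc.IH) (use Suc.prems in auto)
  qed
qed

lemma Ck_on_add:
  assumes "open S" "Ck_on k S f" "Ck_on k S g"
  shows "Ck_on k S (\<lambda>x. f x + g x)"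
  using assms(2,3)
proof (induction k arbitrary: f g)
  case 0
  then show ?case by (auto intro: continuous_intros)
next
  case (Suc k)
  show ?case
  proof (rule Ck_on_SucI[OF assms(1)])
    show "((\<lambda>x. f x + g x) has_derivative (\<lambda>v. dir_deriv v f x + dir_deriv v g x)) (at x)"
      if "x \<in> S" for x
      using Suc.prems that by (intro has_derivative_add has_derivative_dir_deriv) auto
    show "Ck_on k S (\<lambda>x. dir_deriv v f x + dir_deriv v g x)" for v
      by (rule Suc.IH) (use Suc.prems in auto)
  qed
qed

lemma Ck_on_sum:
  assumes "open S" "\<And>i. i \<in> I \<Longrightarrow> Ck_on k S (f i)"
  shows "Ck_on k S (\<lambda>x. \<Sum>i\<in>I. f i x)"
  using assms(2) by (induction I rule: infinite_finite_induct) (auto intro: Ck_on_add[OF assms(1)])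

lemma Ck_on_bilinear:
  assumes "bounded_bilinear B" "open S" "Ck_on k S f" "Ck_on k S g"
  shows "Ck_on k S (\<lambda>x. B (f x) (g x))"
  using assms(3,4)
proof (induction k arbitrary: f g)
  case 0
  then show ?case by (auto intro: bounded_bilinear.continuous_on[OF assms(1)])
next
  case (Suc k)
  show ?case
  proof (rule Ck_on_SucI[OF assms(2)])
    show "((\<lambda>x. B (f x) (g x)) has_derivative
        (\<lambda>v. B (f x) (dir_deriv v g x) + B (dir_deriv v f x) (g x))) (at x)" if "x \<in> S" for x
      using Suc.prems that
      by (intro bounded_bilinear.FDERIV[OF assms(1)] has_derivative_dir_deriv) auto
    have "Ck_on k S f" "Ck_on k S g" using Suc.prems Ck_on_lower by blast+
    then show "Ck_on k S (\<lambda>x. B (f x) (dir_deriv v g x) + B (dir_deriv v f x) (g x))" for v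
      using Suc.prems by (intro Ck_on_add[OF assms(2)] Suc.IH) auto
  qed
qed

text \<open>
  The chain rule evaluates the derivative of \<open>g\<close> in a direction that varies with the point,
  whereas the definition of \<open>Ck_on\<close> speaks about fixed directions.  Expanding the varying
  direction in a basis turns the derivative into a sum of products, to which the induction
  hypothesis applies.
\<close>

lemma Ck_on_compose:
  fixes f :: "'a::real_normed_vector \<Rightarrow> 'b::euclidean_space"
  assumes "open S" "f ` S \<subseteq> T" "Ck_on k S f" "Ck_on k T g"
  shows "Ck_on k S (\<lambda>x. g (f x))"
  using assms(3,4)
proof (induction k arbitrary: g)
  case 0
  then show ?case using assms(2) by (auto intro: continuous_on_compose2)
next
  case (Suc k)
  have fk: "Ck_on k S f" using Suc.prems Ck_on_lower by blast
  have "((\<lambda>x. g (f x)) has_derivative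
      (\<lambda>v. \<Sum>b\<in>Basis. (dir_deriv v f x \<bullet> b) *\<^sub>R dir_deriv b g (f x))) (at x)" if "x \<in> S" for x
  proof -
    have df: "f differentiable at x" and dg: "g differentiable at (f x)"
      using that Suc.prems assms(2) by auto
    show ?thesis
      using diff_chain_at[OF has_derivative_dir_deriv[OF df] has_derivative_dir_deriv[OF dg]]
      by (simp add: comp_def dir_deriv_basis[OF dg, of "dir_deriv _ f x"])
  qed
  moreover have "Ck_on k S (\<lambda>x. \<Sum>b\<in>Basis. (dir_deriv v f x \<bullet> b) *\<^sub>R dir_deriv b g (f x))" for v
    using Suc fk
    by (intro Ck_on_sum[OF assms(1)] Ck_on_bilinear[OF bounded_bilinear_scaleR assms(1)]
        Ck_on_linear_image[OF bounded_linear_inner_left assms(1)] Suc.IH) auto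
  ultimately show ?case by (rule Ck_on_SucI[OF assms(1)])
qed

lemma smooth_on_cong:
  "open S \<Longrightarrow> (\<And>x. x \<in> S \<Longrightarrow> f x = g x) \<Longrightarrow> smooth_on S f \<longleftrightarrow> smooth_on S g"
  unfolding smooth_on_def using Ck_on_cong by blast

lemma smooth_on_subset: "smooth_on S f \<Longrightarrow> T \<subseteq> S \<Longrightarrow> smooth_on T f"
  unfolding smooth_on_def using Ck_on_subset by blast

lemma smooth_on_Un: "open S \<Longrightarrow> open T \<Longrightarrow> smooth_on S f \<Longrightarrow> smooth_on T f \<Longrightarrow> smooth_on (S \<union> T) f"
  unfolding smooth_on_def using Ck_on_Un by blast

lemma smooth_on_const: "smooth_on S (\<lambda>x. c)"
  unfolding smooth_on_def by blast

lemma smooth_on_bounded_linear: "bounded_linear h \<Longrightarrow> smooth_on S h"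
  unfolding smooth_on_def using Ck_on_bounded_linear by blast

lemma smooth_on_linear_image:
  "bounded_linear h \<Longrightarrow> open S \<Longrightarrow> smooth_on S f \<Longrightarrow> smooth_on S (\<lambda>x. h (f x))"
  unfolding smooth_on_def using Ck_on_linear_image by blast

lemma smooth_on_add:
  "open S \<Longrightarrow> smooth_on S f \<Longrightarrow> smooth_on S g \<Longrightarrow> smooth_on S (\<lambda>x. f x + g x)"
  unfolding smooth_on_def using Ck_on_add by blast

lemma smooth_on_sum:
  "open S \<Longrightarrow> (\<And>i. i \<in> I \<Longrightarrow> smooth_on S (f i)) \<Longrightarrow> smooth_on S (\<lambda>x. \<Sum>i\<in>I. f i x)"
  unfolding smooth_on_def by (auto intro: Ck_on_sum)

lemma smooth_on_scaleR:
  "open S \<Longrightarrow> smooth_on S f \<Longrightarrow> smooth_on S g \<Longrightarrow> smooth_on S (\<lambda>x. f x *\<^sub>R g x)"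
  unfolding smooth_on_def using Ck_on_bilinear[OF bounded_bilinear_scaleR] by blast

lemma smooth_on_compose:
  fixes f :: "'a::real_normed_vector \<Rightarrow> 'b::euclidean_space"
  shows "open S \<Longrightarrow> f ` S \<subseteq> T \<Longrightarrow> smooth_on S f \<Longrightarrow> smooth_on T g
    \<Longrightarrow> smooth_on S (\<lambda>x. g (f x))"
  unfolding smooth_on_def using Ck_on_compose by blast

lemma smooth_on_Pair:
  assumes "open S" "smooth_on S f" "smooth_on S g"
  shows "smooth_on S (\<lambda>x. (f x, g x))"
proof -
  have "smooth_on S (\<lambda>x. (f x, 0) + (0, g x))"
    by (intro smooth_on_add assms smooth_on_linear_image[OF bounded_linear_Pair[OF bounded_linear_ident bounded_linear_zero]]
        smooth_on_linear_image[OF bounded_linear_Pair[OF bounded_linear_zero bounded_linear_ident]])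
  then show ?thesis by simp
qed

lemma smooth_on_differentiable: "smooth_on S f \<Longrightarrow> x \<in> S \<Longrightarrow> f differentiable at x"
  unfolding smooth_on_def using Ck_on.simps(2) by blast

lemma smooth_on_dir_deriv: "smooth_on S f \<Longrightarrow> smooth_on S (dir_deriv v f)"
  unfolding smooth_on_def using Ck_on.simps(2) by blast

lemma smooth_on_dir_deriv_vary:
  fixes f :: "'a::euclidean_space \<Rightarrow> 'b::real_normed_vector"
    and g :: "'c::real_normed_vector \<Rightarrow> 'a"
  assumes "open S" "g ` S \<subseteq> T" "smooth_on S g" "smooth_on S w" "smooth_on T f"
  shows "smooth_on S (\<lambda>x. dir_deriv (w x) f (g x))"
proof -
  have "smooth_on S (\<lambda>x. \<Sum>b\<in>Basis. (w x \<bullet> b) *\<^sub>R dir_deriv b f (g x))"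
  proof (intro smooth_on_sum[OF assms(1)] smooth_on_scaleR[OF assms(1)])
    show "smooth_on S (\<lambda>x. w x \<bullet> b)" for b
      by (rule smooth_on_linear_image[OF bounded_linear_inner_left assms(1,4)])
    show "smooth_on S (\<lambda>x. dir_deriv b f (g x))" for b
      by (rule smooth_on_compose[OF assms(1-3) smooth_on_dir_deriv[OF assms(5)]])
  qed
  moreover have "dir_deriv (w x) f (g x) = (\<Sum>b\<in>Basis. (w x \<bullet> b) *\<^sub>R dir_deriv b f (g x))" if "x \<in> S" for x
    using that assms by (intro dir_deriv_basis smooth_on_differentiable[OF assms(5)]) auto
  ultimately show ?thesis
    using smooth_on_cong[OF assms(1)] by (metis (no_types, lifting))
qed


section \<open>Tangent vectors and coordinate changes\<close>

text \<open>
  These three properties are all that calculations in charts require.  They hold for the atlas of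
  a manifold and also for the induced atlas of its slit tangent bundle, so that the
  calculus of tangent vectors is available on both.
\<close>

locale smooth_atlas =
  fixes B :: "('p, 'e::euclidean_space) chart set"
  assumes inj_chart: "C \<in> B \<Longrightarrow> inj_on (snd C) (fst C)"
    and open_overlap: "C \<in> B \<Longrightarrow> C' \<in> B \<Longrightarrow> open (snd C ` (fst C \<inter> fst C'))"
    and compatible_charts: "C \<in> B \<Longrightarrow> C' \<in> B \<Longrightarrow> compatible C C'"
begin

lemma chart_inv_chart [simp]: "C \<in> B \<Longrightarrow> p \<in> fst C \<Longrightarrow> chart_inv C (snd C p) = p"
  by (simp add: chart_inv_def inj_chart)

lemma coord_rep_chart [simp]: "C \<in> B \<Longrightarrow> p \<in> fst C \<Longrightarrow> coord_rep C f (snd C p) = f p"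
  by (simp add: coord_rep_def)

lemma open_chart_image: "C \<in> B \<Longrightarrow> open (snd C ` fst C)"
  using open_overlap[of C C] by simp

lemma smooth_change:
  "C \<in> B \<Longrightarrow> C' \<in> B \<Longrightarrow> smooth_on (snd C ` (fst C \<inter> fst C')) (coord_rep C (snd C'))"
  using compatible_charts by (simp add: compatible_def)

lemma change_differentiable:
  "C \<in> B \<Longrightarrow> C' \<in> B \<Longrightarrow> p \<in> fst C \<Longrightarrow> p \<in> fst C'
    \<Longrightarrow> coord_rep C (snd C') differentiable at (snd C p)"
  by (rule smooth_on_differentiable[OF smooth_change]) auto

lemma open_image_change:
  assumes "C \<in> B" "C' \<in> B" "U \<subseteq> fst C" "open (snd C ` U)"
  shows "open (snd C' ` (U \<inter> fst C'))"
proof -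
  let ?S = "snd C' ` (fst C' \<inter> fst C)" and ?h = "coord_rep C' (snd C)"
  have "continuous_on ?S ?h"
    using smooth_change[OF assms(2,1)] unfolding smooth_on_def using Ck_on_continuous by blast
  then have "open (?S \<inter> ?h -` (snd C ` U))"
    using continuous_open_preimage open_overlap assms by blast
  moreover have "?S \<inter> ?h -` (snd C ` U) = snd C' ` (U \<inter> fst C')"
    using assms inj_onD[OF inj_chart[OF assms(1)]] by (fastforce simp: image_iff)
  ultimately show ?thesis by simp
qed

lemma dir_deriv_change:
  assumes "C \<in> B" "C' \<in> B" "p \<in> fst C" "p \<in> fst C'"
    and "coord_rep C' f differentiable at (snd C' p)"
  shows "dir_deriv v (coord_rep C f) (snd C p)
    = dir_deriv (dir_deriv v (coord_rep C (snd C')) (snd C p)) (coord_rep C' f) (snd C' p)"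
proof -
  have "dir_deriv v (coord_rep C f) (snd C p)
      = dir_deriv v (coord_rep C' f \<circ> coord_rep C (snd C')) (snd C p)"
    by (rule dir_deriv_cong[OF open_overlap[OF assms(1,2)]]) (use assms in auto)
  then show ?thesis
    using dir_deriv_compose[OF change_differentiable[OF assms(1-4)], of "coord_rep C' f" v] assms
    by simp
qed

lemma differentiable_change:
  assumes "C \<in> B" "C' \<in> B" "p \<in> fst C" "p \<in> fst C'"
    and "coord_rep C' f differentiable at (snd C' p)"
  shows "coord_rep C f differentiable at (snd C p)"
proof (rule differentiable_cong[OF open_overlap[OF assms(1,2)]])
  show "coord_rep C' f \<circ> coord_rep C (snd C') differentiable at (snd C p)"
    by (rule differentiable_chain_at[OF change_differentiable[OF assms(1-4)]]) (use assms in auto)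
qed (use assms in auto)

lemma dir_deriv_change_self:
  assumes "C \<in> B" "p \<in> fst C"
  shows "dir_deriv v (coord_rep C (snd C)) (snd C p) = v"
proof -
  have "dir_deriv v (coord_rep C (snd C)) (snd C p) = dir_deriv v (\<lambda>x. x) (snd C p)"
    by (rule dir_deriv_cong[OF open_chart_image[OF assms(1)]]) (use assms in auto)
  then show ?thesis by (simp add: dir_deriv_eq[OF has_derivative_ident])
qed

lemma tangent_change:
  "v \<in> tangent_space B p \<Longrightarrow> C \<in> B \<Longrightarrow> C' \<in> B \<Longrightarrow> p \<in> fst C \<Longrightarrow> p \<in> fst C'
    \<Longrightarrow> v C' = dir_deriv (v C) (coord_rep C (snd C')) (snd C p)"
  unfolding tangent_space_def by blast

lemma tangent_outside:
  "v \<in> tangent_space B p \<Longrightarrow> \<not> (C \<in> B \<and> p \<in> fst C) \<Longrightarrow> v C = 0"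
  unfolding tangent_space_def by blast

lemma tangent_eqI:
  assumes "u \<in> tangent_space B p" "v \<in> tangent_space B p" "C \<in> B" "p \<in> fst C" "u C = v C"
  shows "u = v"
proof
  fix C'
  show "u C' = v C'"
  proof (cases "C' \<in> B \<and> p \<in> fst C'")
    case True
    then show ?thesis
      using tangent_change[OF assms(1,3) _ assms(4)] tangent_change[OF assms(2,3) _ assms(4)] assms(5)
      by auto
  next
    case False
    then show ?thesis using tangent_outside assms(1,2) by metis
  qed
qed

lemma tvec_of_self [simp]: "C \<in> B \<Longrightarrow> p \<in> fst C \<Longrightarrow> tvec_of B C p y C = y"
  by (simp add: tvec_of_def dir_deriv_change_self)

text \<open>
  The chain rule is the cocycle condition that makes the components of \<open>tvec_of\<close> in different
  charts consistent.
\<close>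

lemma tvec_of_tangent:
  assumes "C \<in> B" "p \<in> fst C"
  shows "tvec_of B C p y \<in> tangent_space B p"
  unfolding tangent_space_def
proof (intro CollectI conjI ballI impI allI)
  fix C1 C2 assume "C1 \<in> B" "C2 \<in> B" "p \<in> fst C1 \<inter> fst C2"
  then show "tvec_of B C p y C2 = dir_deriv (tvec_of B C p y C1) (coord_rep C1 (snd C2)) (snd C1 p)"
    using dir_deriv_change[OF assms(1) _ assms(2), of C1 "snd C2" y] change_differentiable[of C1 C2 p]
    by (auto simp: tvec_of_def)
qed (auto simp: tvec_of_def)

lemma tangent_space_lincomb:
  assumes "u \<in> tangent_space B p" "v \<in> tangent_space B p"
  shows "(\<lambda>C. a *\<^sub>R u C + b *\<^sub>R v C) \<in> tangent_space B p"
  unfolding tangent_space_def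
proof (intro CollectI conjI ballI impI allI)
  fix C C' assume C: "C \<in> B" "C' \<in> B" "p \<in> fst C \<inter> fst C'"
  then interpret bounded_linear "\<lambda>v. dir_deriv v (coord_rep C (snd C')) (snd C p)"
    by (intro dir_deriv_linear change_differentiable) auto
  show "a *\<^sub>R u C' + b *\<^sub>R v C'
      = dir_deriv (a *\<^sub>R u C + b *\<^sub>R v C) (coord_rep C (snd C')) (snd C p)"
    using C tangent_change[OF assms(1), of C C'] tangent_change[OF assms(2), of C C'] by (simp add: add scaleR)
qed (use assms in \<open>auto simp: tangent_space_def\<close>)

lemma tangent_space_zero: "(\<lambda>C. 0) \<in> tangent_space B p"
  unfolding tangent_space_def
proof (intro CollectI conjI ballI impI allI)
  fix C C' assume C: "C \<in> B" "C' \<in> B" "p \<in> fst C \<inter> fst C'"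
  then interpret bounded_linear "\<lambda>v. dir_deriv v (coord_rep C (snd C')) (snd C p)"
    by (intro dir_deriv_linear change_differentiable) auto
  show "0 = dir_deriv 0 (coord_rep C (snd C')) (snd C p)" by (simp add: zero)
qed auto

lemma tangent_space_add:
  "u \<in> tangent_space B p \<Longrightarrow> v \<in> tangent_space B p \<Longrightarrow> (\<lambda>C. u C + v C) \<in> tangent_space B p"
  using tangent_space_lincomb[of u p v 1 1] by simp

lemma tangent_space_scaleR:
  "u \<in> tangent_space B p \<Longrightarrow> (\<lambda>C. a *\<^sub>R u C) \<in> tangent_space B p"
  using tangent_space_lincomb[of u p "\<lambda>C. 0" a 1] tangent_space_zero by simp

lemma tangent_space_sum:
  "(\<And>i. i \<in> I \<Longrightarrow> u i \<in> tangent_space B p) \<Longrightarrow> (\<lambda>C. \<Sum>i\<in>I. u i C) \<in> tangent_space B p"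
  by (induction I rule: infinite_finite_induct) (auto intro: tangent_space_zero tangent_space_add)

lemma vec_deriv_eq:
  assumes "v \<in> tangent_space B p" "C \<in> B" "p \<in> fst C" "coord_rep C f differentiable at (snd C p)"
  shows "vec_deriv B p v f = dir_deriv (v C) (coord_rep C f) (snd C p)"
proof -
  define C' where "C' = (SOME C. C \<in> B \<and> p \<in> fst C)"
  have C': "C' \<in> B" "p \<in> fst C'"
    using someI[of "\<lambda>C. C \<in> B \<and> p \<in> fst C" C] assms unfolding C'_def by blast+
  show ?thesis
    using dir_deriv_change[OF C'(1) assms(2) C'(2) assms(3,4)] tangent_change[OF assms(1) C'(1) assms(2) C'(2) assms(3)]
    by (simp add: vec_deriv_def Let_def flip: C'_def)
qed

lemma manifold_open_in_chart:
  assumes "C \<in> B" "U \<subseteq> fst C" "open (snd C ` U)"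
  shows "manifold_open B U"
  unfolding manifold_open_def using assms open_image_change by blast

lemma smooth_fun_in_chart:
  assumes "C \<in> B" "U \<subseteq> fst C" "open (snd C ` U)" "smooth_on (snd C ` U) (coord_rep C f)"
  shows "smooth_fun B U f"
  unfolding smooth_fun_def
proof
  fix C' assume C': "C' \<in> B"
  let ?S = "snd C' ` (U \<inter> fst C')"
  have op: "open ?S" by (rule open_image_change[OF assms(1) C' assms(2,3)])
  have "smooth_on ?S (\<lambda>x. coord_rep C f (coord_rep C' (snd C) x))"
  proof (rule smooth_on_compose[OF op _ _ assms(4)])
    show "coord_rep C' (snd C) ` ?S \<subseteq> snd C ` U" using C' by auto
    show "smooth_on ?S (coord_rep C' (snd C))"
      by (rule smooth_on_subset[OF smooth_change[OF C' assms(1)]]) (use assms in auto)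
  qed
  then show "smooth_on ?S (coord_rep C' f)"
    by (rule iffD1[OF smooth_on_cong[OF op], rotated]) (use C' assms in auto)
qed

text \<open>
  Smoothness of the components in one chart around \<open>U\<close> suffices: in any other chart the
  components are obtained by applying the smoothly varying Jacobian of the coordinate change.
\<close>

lemma vector_field_in_chart:
  assumes "C \<in> B" "U \<subseteq> fst C" "open (snd C ` U)" "\<And>p. p \<in> U \<Longrightarrow> X p \<in> tangent_space B p"
    and "smooth_on (snd C ` U) (coord_rep C (\<lambda>p. X p C))"
  shows "X \<in> vector_fields B U"
  unfolding vector_fields_def
proof (intro CollectI conjI ballI assms(4))
  fix C' assume C': "C' \<in> B"
  let ?S = "snd C' ` (U \<inter> fst C')"
  have op: "open ?S" by (rule open_image_change[OF assms(1) C' assms(2,3)])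
  have sub: "coord_rep C' (snd C) ` ?S \<subseteq> snd C ` U" using C' by auto
  have ch: "smooth_on ?S (coord_rep C' (snd C))"
    by (rule smooth_on_subset[OF smooth_change[OF C' assms(1)]]) (use assms in auto)
  have "smooth_on ?S (\<lambda>x. dir_deriv (coord_rep C (\<lambda>p. X p C) (coord_rep C' (snd C) x))
      (coord_rep C (snd C')) (coord_rep C' (snd C) x))"
  proof (rule smooth_on_dir_deriv_vary[OF op _ ch _ smooth_change[OF assms(1) C']])
    show "coord_rep C' (snd C) ` ?S \<subseteq> snd C ` (fst C \<inter> fst C')" using C' assms by auto
    show "smooth_on ?S (\<lambda>x. coord_rep C (\<lambda>p. X p C) (coord_rep C' (snd C) x))"
      by (rule smooth_on_compose[OF op sub ch assms(5)])
  qed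
  then show "smooth_on ?S (coord_rep C' (\<lambda>p. X p C'))"
  proof (rule iffD1[OF smooth_on_cong[OF op], rotated])
    fix x assume "x \<in> ?S"
    then obtain p where p: "x = snd C' p" "p \<in> U" "p \<in> fst C'" by auto
    moreover have "p \<in> fst C" using p assms by auto
    ultimately show "dir_deriv (coord_rep C (\<lambda>p. X p C) (coord_rep C' (snd C) x))
      (coord_rep C (snd C')) (coord_rep C' (snd C) x) = coord_rep C' (\<lambda>p. X p C') x"
      using tangent_change[OF assms(4)[OF p(2)] assms(1) C'] C' assms by simp
  qed
qed

end


section \<open>The slit tangent bundle\<close>

definition slit_over ::
    "('m, 'e::real_normed_vector) chart set \<Rightarrow> 'm set \<Rightarrow> ('m \<times> ('m, 'e) tvec) set" where
  "slit_over B U = {\<xi> \<in> slit_bundle B. fst \<xi> \<in> U}"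

lemma slit_chart_domain: "fst (slit_chart B C) = slit_over B (fst C)"
  by (auto simp: slit_chart_def slit_over_def)

lemma slit_chart_apply [simp]: "snd (slit_chart B C) \<xi> = (snd C (fst \<xi>), snd \<xi> C)"
  by (simp add: slit_chart_def case_prod_beta)

lemma image_times_nonzeroE:
  assumes "z \<in> h ` U \<times> (- {0 :: 'e::zero})"
  obtains p y where "z = (h p, y)" "p \<in> U" "y \<noteq> 0"
  using assms by (cases z) blast

context smooth_atlas
begin

lemma tangent_nonzero:
  assumes "v \<in> tangent_space B p" "C \<in> B" "p \<in> fst C" "v \<noteq> (\<lambda>_. 0)"
  shows "v C \<noteq> 0"
  using tangent_eqI[OF assms(1) tangent_space_zero assms(2,3)] assms(4) by auto

lemma slit_point:
  assumes "C \<in> B" "p \<in> fst C" "y \<noteq> 0"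
  shows "(p, tvec_of B C p y) \<in> slit_bundle B"
  using tvec_of_tangent[OF assms(1,2), of y] tvec_of_self[OF assms(1,2), of y] assms(3)
  unfolding slit_bundle_def by force

lemma slit_over_tangent:
  "\<xi> \<in> slit_over B U \<Longrightarrow> snd \<xi> \<in> tangent_space B (fst \<xi>) \<and> snd \<xi> \<noteq> (\<lambda>_. 0) \<and> fst \<xi> \<in> U"
  by (auto simp: slit_over_def slit_bundle_def)

lemma slit_image:
  assumes "C \<in> B"
  shows "snd (slit_chart B C) ` (slit_over B U \<inter> slit_over B (fst C)) = snd C ` (U \<inter> fst C) \<times> (- {0})"
proof (intro equalityI subsetI)
  fix z assume "z \<in> snd (slit_chart B C) ` (slit_over B U \<inter> slit_over B (fst C))"
  then show "z \<in> snd C ` (U \<inter> fst C) \<times> (- {0})"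
    using slit_over_tangent tangent_nonzero[OF _ assms] by fastforce
next
  fix z assume "z \<in> snd C ` (U \<inter> fst C) \<times> (- {0 :: 'e})"
  then obtain p where p: "p \<in> U" "p \<in> fst C" "fst z = snd C p" "snd z \<noteq> 0"
    by (elim image_times_nonzeroE) auto
  have "(p, tvec_of B C p (snd z)) \<in> slit_over B U \<inter> slit_over B (fst C)"
    using slit_point[OF assms p(2,4)] p by (simp add: slit_over_def)
  moreover have "z = snd (slit_chart B C) (p, tvec_of B C p (snd z))"
    using p assms by (simp add: prod_eq_iff)
  ultimately show "z \<in> snd (slit_chart B C) ` (slit_over B U \<inter> slit_over B (fst C))" by blast
qed

lemma inj_slit_chart:
  assumes "C \<in> B"
  shows "inj_on (snd (slit_chart B C)) (fst (slit_chart B C))"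
proof (rule inj_onI)
  fix \<xi> \<eta>
  assume m: "\<xi> \<in> fst (slit_chart B C)" "\<eta> \<in> fst (slit_chart B C)"
    and eq: "snd (slit_chart B C) \<xi> = snd (slit_chart B C) \<eta>"
  have *: "fst \<xi> \<in> fst C" "fst \<eta> \<in> fst C" "snd \<xi> \<in> tangent_space B (fst \<xi>)" "snd \<eta> \<in> tangent_space B (fst \<eta>)"
    using m slit_over_tangent unfolding slit_chart_domain by blast+
  have "fst \<xi> = fst \<eta>" using eq * inj_onD[OF inj_chart[OF assms]] by auto
  moreover have "snd \<xi> = snd \<eta>"
    by (rule tangent_eqI[OF _ _ assms]) (use eq * calculation in auto)
  ultimately show "\<xi> = \<eta>" by (simp add: prod_eq_iff)
qed

lemma slit_chart_inv:
  assumes "C \<in> B" "p \<in> fst C" "y \<noteq> 0"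
  shows "chart_inv (slit_chart B C) (snd C p, y) = (p, tvec_of B C p y)"
proof -
  have "(p, tvec_of B C p y) \<in> fst (slit_chart B C)"
    using slit_point[OF assms] assms by (simp add: slit_chart_domain slit_over_def)
  from inv_into_f_f[OF inj_slit_chart[OF assms(1)] this]
  show ?thesis using assms by (simp add: chart_inv_def)
qed

lemma coord_rep_slit:
  assumes "C \<in> B" "p \<in> fst C" "y \<noteq> 0"
  shows "coord_rep (slit_chart B C) f (snd C p, y) = f (p, tvec_of B C p y)"
  using slit_chart_inv[OF assms] by (simp add: coord_rep_def)

lemma coord_rep_slit_lift:
  assumes "C \<in> B" "z \<in> snd C ` fst C \<times> (- {0})"
  shows "coord_rep (slit_chart B C) (\<lambda>\<xi>. f (fst \<xi>)) z = coord_rep C f (fst z)"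
  using assms(2) by (elim image_times_nonzeroE) (simp add: assms(1) coord_rep_slit)

lemma slit_change:
  assumes "C \<in> B" "C' \<in> B" "z \<in> snd C ` (fst C \<inter> fst C') \<times> (- {0})"
  shows "coord_rep (slit_chart B C) (snd (slit_chart B C')) z
    = (coord_rep C (snd C') (fst z), dir_deriv (snd z) (coord_rep C (snd C')) (fst z))"
  using assms(3)
  by (elim image_times_nonzeroE) (simp add: assms(1,2) coord_rep_slit tvec_of_def)

lemma slit_smooth_change:
  assumes "C \<in> B" "C' \<in> B"
  shows "smooth_on (snd C ` (fst C \<inter> fst C') \<times> (- {0})) (coord_rep (slit_chart B C) (snd (slit_chart B C')))"
proof -
  let ?S = "snd C ` (fst C \<inter> fst C')" and ?h = "coord_rep C (snd C')"
  have op: "open (?S \<times> (- {0 :: 'e}))" by (intro open_Times open_overlap assms) auto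
  have "smooth_on (?S \<times> (- {0})) (\<lambda>z. (?h (fst z), dir_deriv (snd z) ?h (fst z)))"
  proof (rule smooth_on_Pair[OF op])
    show "smooth_on (?S \<times> (- {0 :: 'e})) (\<lambda>z. ?h (fst z))"
      by (rule smooth_on_compose[OF op _ smooth_on_bounded_linear[OF bounded_linear_fst] smooth_change[OF assms]]) auto
    show "smooth_on (?S \<times> (- {0})) (\<lambda>z. dir_deriv (snd z) ?h (fst z))"
      by (rule smooth_on_dir_deriv_vary[OF op _ smooth_on_bounded_linear[OF bounded_linear_fst]
            smooth_on_bounded_linear[OF bounded_linear_snd] smooth_change[OF assms]]) auto
  qed
  then show ?thesis
    by (rule iffD1[OF smooth_on_cong[OF op], rotated]) (rule slit_change[OF assms, symmetric])
qed

lemma slit_smooth_atlas: "smooth_atlas (slit_atlas B)"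
proof
  fix D D' assume "D \<in> slit_atlas B"
  then obtain C where C: "C \<in> B" "D = slit_chart B C" by (auto simp: slit_atlas_def)
  show "inj_on (snd D) (fst D)" using inj_slit_chart C by simp
  assume "D' \<in> slit_atlas B"
  then obtain C' where C': "C' \<in> B" "D' = slit_chart B C'" by (auto simp: slit_atlas_def)
  have im: "snd D ` (fst D \<inter> fst D') = snd C ` (fst C \<inter> fst C') \<times> (- {0})"
    "snd D' ` (fst D \<inter> fst D') = snd C' ` (fst C' \<inter> fst C) \<times> (- {0})"
    using slit_image[OF C(1), of "fst C'"] slit_image[OF C'(1), of "fst C"]
    unfolding C C' slit_chart_domain by (simp_all add: Int_commute)
  show "open (snd D ` (fst D \<inter> fst D'))"
    unfolding im by (intro open_Times open_overlap C C') auto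
  show "compatible D D'"
    unfolding compatible_def im using slit_smooth_change C C' by blast
qed

lemma open_slit_image:
  assumes "manifold_open B U" "C \<in> B"
  shows "open (snd C ` (U \<inter> fst C) \<times> (- {0 :: 'e}))"
  using assms by (intro open_Times) (auto simp: manifold_open_def)

lemma manifold_open_slit_over:
  assumes "manifold_open B U"
  shows "manifold_open (slit_atlas B) (slit_over B U)"
  unfolding manifold_open_def
proof
  show "slit_over B U \<subseteq> (\<Union>D\<in>slit_atlas B. fst D)"
    using assms unfolding slit_atlas_def manifold_open_def
    by (fastforce simp: slit_chart_domain slit_over_def)
  show "\<forall>D\<in>slit_atlas B. open (snd D ` (slit_over B U \<inter> fst D))"
    using open_slit_image[OF assms] slit_image
    by (auto simp: slit_atlas_def slit_chart_domain)
qed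

lemma smooth_fun_lift:
  assumes "manifold_open B U" "smooth_fun B U f"
  shows "smooth_fun (slit_atlas B) (slit_over B U) (\<lambda>\<xi>. f (fst \<xi>))"
  unfolding smooth_fun_def
proof
  fix D assume "D \<in> slit_atlas B"
  then obtain C where C: "C \<in> B" "D = slit_chart B C" by (auto simp: slit_atlas_def)
  let ?S = "snd C ` (U \<inter> fst C) \<times> (- {0 :: 'e})"
  note op = open_slit_image[OF assms(1) C(1)]
  have "smooth_on (snd C ` (U \<inter> fst C)) (coord_rep C f)"
    using assms(2) C by (auto simp: smooth_fun_def)
  then have "smooth_on ?S (\<lambda>z. coord_rep C f (fst z))"
    by (rule smooth_on_compose[OF op _ smooth_on_bounded_linear[OF bounded_linear_fst], rotated]) auto
  then have "smooth_on ?S (coord_rep D (\<lambda>\<xi>. f (fst \<xi>)))"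
    by (rule iffD1[OF smooth_on_cong[OF op], rotated]) (use C coord_rep_slit_lift[OF C(1), of _ f, symmetric] in blast)
  then show "smooth_on (snd D ` (slit_over B U \<inter> fst D)) (coord_rep D (\<lambda>\<xi>. f (fst \<xi>)))"
    using slit_image[OF C(1)] C by (simp add: slit_chart_domain)
qed

lemma lift_field_section:
  assumes "manifold_open B U" "X \<in> vector_fields B U"
  shows "lift_field X \<in> pb_sections B (slit_over B U)"
  unfolding pb_sections_def
proof (intro CollectI conjI ballI)
  show "lift_field X \<xi> \<in> tangent_space B (fst \<xi>)" if "\<xi> \<in> slit_over B U" for \<xi>
    using that assms(2) by (auto simp: lift_field_def slit_over_def vector_fields_def)
  fix C assume C: "C \<in> B"
  let ?S = "snd C ` (U \<inter> fst C) \<times> (- {0 :: 'e})"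
  note op = open_slit_image[OF assms(1) C(1)]
  have "smooth_on (snd C ` (U \<inter> fst C)) (coord_rep C (\<lambda>p. X p C))"
    using assms(2) C by (auto simp: vector_fields_def)
  then have "smooth_on ?S (\<lambda>z. coord_rep C (\<lambda>p. X p C) (fst z))"
    by (rule smooth_on_compose[OF op _ smooth_on_bounded_linear[OF bounded_linear_fst], rotated]) auto
  then have "smooth_on ?S (coord_rep (slit_chart B C) (\<lambda>\<xi>. X (fst \<xi>) C))"
    by (rule iffD1[OF smooth_on_cong[OF op], rotated])
      (use coord_rep_slit_lift[OF C(1), of _ "\<lambda>p. X p C", symmetric] in blast)
  then show "smooth_on (snd (slit_chart B C) ` (slit_over B U \<inter> fst (slit_chart B C)))
      (coord_rep (slit_chart B C) (\<lambda>\<xi>. lift_field X \<xi> C))"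
    using slit_image[OF C(1)] C by (simp add: slit_chart_domain lift_field_def)
qed

end


section \<open>Connections on the pulled-back bundle\<close>

context smooth_atlas
begin

lemma section_image_open:
  "manifold_open (slit_atlas B) W \<Longrightarrow> C \<in> B
    \<Longrightarrow> open (snd (slit_chart B C) ` (W \<inter> fst (slit_chart B C)))"
  by (auto simp: manifold_open_def slit_atlas_def)

lemma pb_sections_add:
  assumes "manifold_open (slit_atlas B) W" "s \<in> pb_sections B W" "t \<in> pb_sections B W"
  shows "(\<lambda>\<eta> c. s \<eta> c + t \<eta> c) \<in> pb_sections B W"
  unfolding pb_sections_def
proof (intro CollectI conjI ballI)
  show "(\<lambda>c. s \<xi> c + t \<xi> c) \<in> tangent_space B (fst \<xi>)" if "\<xi> \<in> W" for \<xi>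
    using that assms(2,3) by (auto simp: pb_sections_def intro: tangent_space_add)
  fix C assume C: "C \<in> B"
  let ?D = "slit_chart B C"
  have "smooth_on (snd ?D ` (W \<inter> fst ?D)) (coord_rep ?D (\<lambda>\<eta>. s \<eta> C))"
    "smooth_on (snd ?D ` (W \<inter> fst ?D)) (coord_rep ?D (\<lambda>\<eta>. t \<eta> C))"
    using assms C by (auto simp: pb_sections_def)
  from smooth_on_add[OF section_image_open[OF assms(1) C] this]
  show "smooth_on (snd ?D ` (W \<inter> fst ?D)) (coord_rep ?D (\<lambda>\<eta>. s \<eta> C + t \<eta> C))"
    by (simp add: coord_rep_def comp_def)
qed

lemma pb_sections_zero: "(\<lambda>\<eta> c. 0) \<in> pb_sections B W"
  by (auto simp: pb_sections_def coord_rep_def comp_def intro: tangent_space_zero smooth_on_const)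

lemma pb_sections_scaleR:
  assumes "manifold_open (slit_atlas B) W" "s \<in> pb_sections B W"
    and "smooth_fun (slit_atlas B) W f"
  shows "(\<lambda>\<eta> c. f \<eta> *\<^sub>R s \<eta> c) \<in> pb_sections B W"
  unfolding pb_sections_def
proof (intro CollectI conjI ballI)
  show "(\<lambda>c. f \<xi> *\<^sub>R s \<xi> c) \<in> tangent_space B (fst \<xi>)" if "\<xi> \<in> W" for \<xi>
    using that assms(2) by (auto simp: pb_sections_def intro: tangent_space_scaleR)
  fix C assume C: "C \<in> B"
  let ?D = "slit_chart B C"
  have "smooth_on (snd ?D ` (W \<inter> fst ?D)) (coord_rep ?D f)"
    "smooth_on (snd ?D ` (W \<inter> fst ?D)) (coord_rep ?D (\<lambda>\<eta>. s \<eta> C))"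
    using assms C by (auto simp: smooth_fun_def slit_atlas_def pb_sections_def)
  from smooth_on_scaleR[OF section_image_open[OF assms(1) C] this]
  show "smooth_on (snd ?D ` (W \<inter> fst ?D)) (coord_rep ?D (\<lambda>\<eta>. f \<eta> *\<^sub>R s \<eta> C))"
    by (simp add: coord_rep_def comp_def)
qed

lemma pb_sections_sum:
  assumes "manifold_open (slit_atlas B) W" "\<And>i. i \<in> I \<Longrightarrow> s i \<in> pb_sections B W"
    and "\<And>i. i \<in> I \<Longrightarrow> smooth_fun (slit_atlas B) W (f i)"
  shows "(\<lambda>\<eta> c. \<Sum>i\<in>I. f i \<eta> *\<^sub>R s i \<eta> c) \<in> pb_sections B W"
  using assms(2,3)
proof (induction I rule: infinite_finite_induct)
  case (insert i I)
  then show ?case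
    using pb_sections_add[OF assms(1) pb_sections_scaleR[OF assms(1), of "s i" "f i"]] by auto
qed (auto simp: pb_sections_zero)

text \<open>
  A derivation sees a function only near the point.  Values of \<open>f\<close> outside \<open>W\<close> do not matter,
  which is why this applies to the indicator function of \<open>W\<close>.
\<close>

lemma vec_deriv_locally_constant:
  fixes k :: "'b::real_normed_vector"
  assumes "manifold_open B W" "p \<in> W" "v \<in> tangent_space B p" "\<And>q. q \<in> W \<Longrightarrow> f q = k"
  shows "vec_deriv B p v f = 0"
proof -
  obtain C where C: "C \<in> B" "p \<in> fst C" using assms by (auto simp: manifold_open_def)
  have op: "open (snd C ` (W \<inter> fst C))" "snd C p \<in> snd C ` (W \<inter> fst C)"
    using assms C by (auto simp: manifold_open_def)
  have eq: "k = coord_rep C f x" if "x \<in> snd C ` (W \<inter> fst C)" for x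
    using that C assms(4) by auto
  have "coord_rep C f differentiable at (snd C p)"
    by (rule differentiable_cong[OF op eq]) auto
  then show ?thesis
    using vec_deriv_eq[OF assms(3) C, of f] dir_deriv_cong[OF op eq, where v = "v C"] by simp
qed

lemma connection_add:
  assumes "linear_connection B nabla" "manifold_open (slit_atlas B) W"
    and "s \<in> pb_sections B W" "t \<in> pb_sections B W"
    and "\<xi> \<in> W" "\<zeta> \<in> tangent_space (slit_atlas B) \<xi>"
  shows "nabla \<xi> \<zeta> (\<lambda>\<eta> c. s \<eta> c + t \<eta> c) = (\<lambda>c. nabla \<xi> \<zeta> s c + nabla \<xi> \<zeta> t c)"
  using assms unfolding linear_connection_def by blast

lemma connection_Leibniz:
  fixes f :: "'p \<times> ('p, 'e) tvec \<Rightarrow> real"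
  assumes "linear_connection B nabla" "manifold_open (slit_atlas B) W"
    and "s \<in> pb_sections B W" "smooth_fun (slit_atlas B) W f"
    and "\<xi> \<in> W" "\<zeta> \<in> tangent_space (slit_atlas B) \<xi>"
  shows "nabla \<xi> \<zeta> (\<lambda>\<eta> c. f \<eta> *\<^sub>R s \<eta> c)
    = (\<lambda>c. vec_deriv (slit_atlas B) \<xi> \<zeta> f *\<^sub>R s \<xi> c + f \<xi> *\<^sub>R nabla \<xi> \<zeta> s c)"
  using assms unfolding linear_connection_def by blast

lemma connection_tangent:
  assumes "linear_connection B nabla" "manifold_open (slit_atlas B) W"
    and "s \<in> pb_sections B W" "\<xi> \<in> W" "\<zeta> \<in> tangent_space (slit_atlas B) \<xi>"
  shows "nabla \<xi> \<zeta> s \<in> tangent_space B (fst \<xi>)"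
  using assms unfolding linear_connection_def by blast

text \<open>
  Multiplication by the indicator function \<open>f\<close> of \<open>W\<close> makes \<open>s\<close> and \<open>t\<close> equal everywhere, and by
  the Leibniz rule it does not change their covariant derivatives on \<open>W\<close>: there \<open>f = 1\<close> and the
  derivatives of \<open>f\<close> vanish.
\<close>

lemma connection_local:
  assumes "linear_connection B nabla" "manifold_open (slit_atlas B) W"
    and "s \<in> pb_sections B W" "t \<in> pb_sections B W"
    and "\<xi> \<in> W" "\<zeta> \<in> tangent_space (slit_atlas B) \<xi>"
    and "\<And>\<eta>. \<eta> \<in> W \<Longrightarrow> s \<eta> = t \<eta>"
  shows "nabla \<xi> \<zeta> s = nabla \<xi> \<zeta> t"
proof -
  interpret slit: smooth_atlas "slit_atlas B" by (rule slit_smooth_atlas)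
  let ?f = "\<lambda>\<eta>. of_bool (\<eta> \<in> W) :: real"
  have sm: "smooth_fun (slit_atlas B) W ?f"
    unfolding smooth_fun_def
  proof
    fix D assume D: "D \<in> slit_atlas B"
    have op: "open (snd D ` (W \<inter> fst D))" using assms(2) D by (auto simp: manifold_open_def)
    show "smooth_on (snd D ` (W \<inter> fst D)) (coord_rep D ?f)"
      by (rule iffD1[OF smooth_on_cong[OF op] smooth_on_const[of _ 1]]) (use D in auto)
  qed
  have d: "vec_deriv (slit_atlas B) \<xi> \<zeta> ?f = 0"
    by (rule slit.vec_deriv_locally_constant[OF assms(2,5,6), of _ 1]) simp
  have L: "nabla \<xi> \<zeta> (\<lambda>\<eta> c. ?f \<eta> *\<^sub>R s' \<eta> c) = nabla \<xi> \<zeta> s'" if "s' \<in> pb_sections B W" for s'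
    using connection_Leibniz[OF assms(1,2) that sm assms(5,6)] d assms(5) by simp
  have "(\<lambda>\<eta> c. ?f \<eta> *\<^sub>R s \<eta> c) = (\<lambda>\<eta> c. ?f \<eta> *\<^sub>R t \<eta> c)"
    using assms(7) by (auto simp: fun_eq_iff)
  then show ?thesis using L[OF assms(3)] L[OF assms(4)] by simp
qed

lemma connection_sum:
  assumes "linear_connection B nabla" "manifold_open (slit_atlas B) W"
    and "\<And>i. i \<in> I \<Longrightarrow> s i \<in> pb_sections B W"
    and "\<And>i. i \<in> I \<Longrightarrow> smooth_fun (slit_atlas B) W (f i)"
    and "\<xi> \<in> W" "\<zeta> \<in> tangent_space (slit_atlas B) \<xi>"
  shows "nabla \<xi> \<zeta> (\<lambda>\<eta> c. \<Sum>i\<in>I. f i \<eta> *\<^sub>R s i \<eta> c)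
    = (\<lambda>c. \<Sum>i\<in>I. vec_deriv (slit_atlas B) \<xi> \<zeta> (f i) *\<^sub>R s i \<xi> c + f i \<xi> *\<^sub>R nabla \<xi> \<zeta> (s i) c)"
proof -
  interpret slit: smooth_atlas "slit_atlas B" by (rule slit_smooth_atlas)
  have sm: "smooth_fun (slit_atlas B) W (\<lambda>_. 0::real)"
    by (auto simp: smooth_fun_def coord_rep_def comp_def smooth_on_const)
  have "vec_deriv (slit_atlas B) \<xi> \<zeta> (\<lambda>_. 0::real) = 0"
    by (rule slit.vec_deriv_locally_constant[OF assms(2,5,6)]) simp
  then have zero: "nabla \<xi> \<zeta> (\<lambda>\<eta> c. 0) = (\<lambda>c. 0)"
    using connection_Leibniz[OF assms(1,2) pb_sections_zero sm assms(5,6)] by simp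
  show ?thesis
    using assms(3,4)
  proof (induction I rule: infinite_finite_induct)
    case (insert i I)
    have "nabla \<xi> \<zeta> (\<lambda>\<eta> c. f i \<eta> *\<^sub>R s i \<eta> c + (\<Sum>i\<in>I. f i \<eta> *\<^sub>R s i \<eta> c))
        = (\<lambda>c. nabla \<xi> \<zeta> (\<lambda>\<eta> c. f i \<eta> *\<^sub>R s i \<eta> c) c + nabla \<xi> \<zeta> (\<lambda>\<eta> c. \<Sum>i\<in>I. f i \<eta> *\<^sub>R s i \<eta> c) c)"
      by (rule connection_add[OF assms(1,2) pb_sections_scaleR[OF assms(2)] pb_sections_sum[OF assms(2)] assms(5,6)])
        (use insert.prems in auto)
    then show ?case
      using insert connection_Leibniz[OF assms(1,2) insert.prems(1)[of i] insert.prems(2)[of i] assms(5,6)]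
      by simp
  qed (simp_all add: zero)
qed

end


section \<open>Norms that do not depend on the base point\<close>

text \<open>
  The argument that the Levi-Civita connection of a constant metric vanishes, for connection forms
  given on the tangent vectors \<open>\<zeta> \<in> T\<close> of a bundle over the base.  By \<open>torsion\<close> the forms
  contain \<open>dx\<close> only, with coefficients \<open>\<Gamma>\<^sup>i\<^sub>j\<^sub>l\<close> symmetric in \<open>j\<close> and \<open>l\<close>.  Lowering the upper index of
  \<open>\<Gamma>\<close> with \<open>g\<close> or with its transpose gives two families \<open>b\<close> and \<open>b'\<close>, and \<open>metric\<close> says that
  \<open>b'\<^sub>j\<^sub>i\<^sub>l = - b\<^sub>i\<^sub>j\<^sub>l\<close>.  With the symmetry in the last two indices this makes \<open>b\<close> totally symmetric
  and \<open>b' = - b\<close>, so the vectors \<open>\<Gamma>\<^sup>\<cdot>\<^sub>j\<^sub>l\<close> are null for the quadratic form of \<open>g\<close>,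
  which is positive definite.
\<close>

lemma torsion_free_metric_zero:
  fixes g :: "'d::finite \<Rightarrow> 'd \<Rightarrow> real" and \<theta> :: "'d \<Rightarrow> 'd \<Rightarrow> 'z \<Rightarrow> real" and dx :: "'z \<Rightarrow> real^'d"
  assumes pos: "\<And>w :: real^'d. w \<noteq> 0 \<Longrightarrow> 0 < (\<Sum>i\<in>UNIV. \<Sum>j\<in>UNIV. g i j * w $ i * w $ j)"
    and torsion: "\<And>\<zeta> \<zeta>' i. \<zeta> \<in> T \<Longrightarrow> \<zeta>' \<in> T \<Longrightarrow>
      (\<Sum>j\<in>UNIV. dx \<zeta> $ j * \<theta> i j \<zeta>' - dx \<zeta>' $ j * \<theta> i j \<zeta>) = 0"
    and metric: "\<And>\<zeta> i j. \<zeta> \<in> T \<Longrightarrow>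
      (\<Sum>k\<in>UNIV. g k j * \<theta> k i \<zeta>) + (\<Sum>k\<in>UNIV. g i k * \<theta> k j \<zeta>) = 0"
    and surj: "\<And>a. \<exists>\<zeta>\<in>T. dx \<zeta> = a"
    and "\<zeta> \<in> T"
  shows "\<theta> i j \<zeta> = 0"
proof -
  have "\<exists>e. \<forall>l. e l \<in> T \<and> dx (e l) = axis l 1"
    by (rule choice) (use surj in blast)
  then obtain e where e: "\<And>l. e l \<in> T" "\<And>l. dx (e l) = axis l 1"
    by blast
  have expand: "\<theta> i j \<zeta>' = (\<Sum>l\<in>UNIV. dx \<zeta>' $ l * \<theta> i l (e j))" if "\<zeta>' \<in> T" for i j \<zeta>'
    using torsion[OF e(1) that, of j i]
    by (simp add: e(2) sum_subtractf axis_def if_distrib[of "\<lambda>x. x * _"] cong: if_cong)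
  have sym: "\<theta> i j (e l) = \<theta> i l (e j)" for i j l
    using expand[OF e(1), of i j l]
    by (simp add: e(2) axis_def if_distrib[of "\<lambda>x. x * _"] cong: if_cong)
  define b where "b i j l = (\<Sum>k\<in>UNIV. g i k * \<theta> k j (e l))" for i j l
  define b' where "b' i j l = (\<Sum>k\<in>UNIV. g k i * \<theta> k j (e l))" for i j l
  have bs: "b i j l = b i l j" "b' i j l = b' i l j" for i j l
    unfolding b_def b'_def by (subst sym, rule refl)+
  have bm: "b' j i l = - b i j l" for i j l
    using metric[OF e(1), of j i l] unfolding b_def b'_def by simp
  \<comment> \<open>Alternate between exchanging the first two indices (\<open>bm\<close>) and the last two (\<open>bs\<close>).\<close>
  have tot: "b i j l = b j i l" for i j l
    using bm[of j i l] bm[of j l i] bs(2)[of j i l] bs(1)[of l j i] bm[of i l j] bm[of i j l] bs(2)[of i l j]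
    by simp
  have "\<theta> i j (e l) = 0" for i j l
  proof (rule ccontr)
    assume "\<theta> i j (e l) \<noteq> 0"
    define w :: "real^'d" where "w = (\<chi> k. \<theta> k j (e l))"
    have "w \<noteq> 0" using \<open>\<theta> i j (e l) \<noteq> 0\<close> by (auto simp: w_def vec_eq_iff)
    have 1: "(\<Sum>i\<in>UNIV. \<Sum>k\<in>UNIV. g i k * w $ i * w $ k) = (\<Sum>i\<in>UNIV. w $ i * b i j l)"
      by (simp add: b_def w_def sum_distrib_left mult_ac)
    have "(\<Sum>i\<in>UNIV. \<Sum>k\<in>UNIV. g i k * w $ i * w $ k) = (\<Sum>k\<in>UNIV. \<Sum>i\<in>UNIV. g i k * w $ i * w $ k)"
      by (rule sum.swap)
    also have "\<dots> = (\<Sum>k\<in>UNIV. w $ k * b' k j l)"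
      by (simp add: b'_def w_def sum_distrib_left mult_ac)
    also have "\<dots> = - (\<Sum>k\<in>UNIV. w $ k * b k j l)"
      using bm tot by (simp add: sum_negf)
    finally show False using 1 pos[OF \<open>w \<noteq> 0\<close>] by simp
  qed
  then show ?thesis using expand[OF assms(5), of i j] by simp
qed

lemma dir_deriv_along_ray:
  assumes "\<And>t. t > 0 \<Longrightarrow> f (t *\<^sub>R y) = 0" "s > 0" "f differentiable at (s *\<^sub>R y)"
  shows "dir_deriv y f (s *\<^sub>R y) = 0"
proof -
  have "((f \<circ> (\<lambda>t. t *\<^sub>R y)) has_derivative (\<lambda>v. dir_deriv v f (s *\<^sub>R y)) \<circ> (\<lambda>h. h *\<^sub>R y)) (at s)"
  proof (rule diff_chain_at)
    show "((\<lambda>t. t *\<^sub>R y) has_derivative (\<lambda>h. h *\<^sub>R y)) (at s)"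
      by (auto intro!: derivative_eq_intros)
  qed (rule has_derivative_dir_deriv[OF assms(3)])
  then have "dir_deriv 1 (f \<circ> (\<lambda>t. t *\<^sub>R y)) s = dir_deriv y f (s *\<^sub>R y)"
    by (simp add: dir_deriv_eq)
  moreover have "dir_deriv 1 (f \<circ> (\<lambda>t. t *\<^sub>R y)) s = dir_deriv 1 (\<lambda>_. 0) s"
    by (rule dir_deriv_cong[of "{0<..}"]) (use assms in auto)
  ultimately show ?thesis by simp
qed

lemma smooth_half_square:
  fixes \<Phi> :: "'a::real_normed_vector \<Rightarrow> real"
  assumes "open S" "smooth_on S \<Phi>"
  shows "smooth_on S (\<lambda>y. (\<Phi> y)\<^sup>2 / 2)"
  using smooth_on_linear_image[OF bounded_linear_scaleR_right[of "1/2"] assms(1)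
      smooth_on_scaleR[OF assms(1,2,2)]]
  by (simp add: power2_eq_square)

text \<open>
  If \<open>\<Phi>\<close> vanished at \<open>y\<close>, it would vanish by homogeneity on the ray through \<open>y\<close>, and so would the
  second derivative of \<open>\<Phi>\<^sup>2 / 2\<close> in the direction of the ray, which is the value
  on \<open>y\<close> of the positive-definite Hessian at \<open>y\<close>.
\<close>

lemma minkowski_norm_pos:
  fixes \<Phi> :: "real^'d \<Rightarrow> real"
  assumes "minkowski_norm \<Phi>" "y \<noteq> 0"
  shows "\<Phi> y > 0"
proof (rule ccontr)
  assume "\<not> \<Phi> y > 0"
  moreover have "\<Phi> y \<ge> 0" using assms unfolding minkowski_norm_def by blast
  ultimately have z: "\<Phi> y = 0" by simp
  let ?Q = "\<lambda>y. (\<Phi> y)\<^sup>2 / 2"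
  have op: "open (- {0 :: real^'d})" by auto
  have sm: "smooth_on (- {0}) ?Q"
    using assms unfolding minkowski_norm_def by (blast intro: smooth_half_square[OF op])
  have smd: "smooth_on (- {0}) (dir_deriv v ?Q)" for v by (rule smooth_on_dir_deriv[OF sm])
  have Q0: "?Q (t *\<^sub>R y) = 0" if "t > 0" for t
    using assms z that unfolding minkowski_norm_def by simp
  have D0: "dir_deriv y ?Q (t *\<^sub>R y) = 0" if "t > 0" for t
    by (rule dir_deriv_along_ray[OF Q0 that smooth_on_differentiable[OF sm]]) (use assms that in auto)
  have "dir_deriv y (dir_deriv y ?Q) (1 *\<^sub>R y) = 0"
    by (rule dir_deriv_along_ray[OF D0 _ smooth_on_differentiable[OF smd]]) (use assms in auto)
  moreover have "dir_deriv v (dir_deriv y ?Q) y = (\<Sum>i\<in>UNIV. (y $ i) *\<^sub>R dir_deriv v (dir_deriv (axis i 1) ?Q) y)" for v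
  proof -
    have "dir_deriv v (dir_deriv y ?Q) y = dir_deriv v (\<lambda>x. \<Sum>i\<in>UNIV. (y $ i) *\<^sub>R dir_deriv (axis i 1) ?Q x) y"
      by (rule dir_deriv_cong[OF op]) (use assms in \<open>auto intro: dir_deriv_axes[OF smooth_on_differentiable[OF sm], of _ y, simplified]\<close>)
    also have "\<dots> = (\<Sum>i\<in>UNIV. (y $ i) *\<^sub>R dir_deriv v (dir_deriv (axis i 1) ?Q) y)"
      by (intro dir_deriv_eq has_derivative_sum bounded_linear.has_derivative[OF bounded_linear_scaleR_right]
          has_derivative_dir_deriv smooth_on_differentiable[OF smd]) (use assms in auto)
    finally show ?thesis .
  qed
  moreover have "dir_deriv y (dir_deriv y ?Q) y = (\<Sum>j\<in>UNIV. (y $ j) *\<^sub>R dir_deriv (axis j 1) (dir_deriv y ?Q) y)"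
    by (rule dir_deriv_axes[OF smooth_on_differentiable[OF smd]]) (use assms in auto)
  ultimately have "(\<Sum>j\<in>UNIV. \<Sum>i\<in>UNIV. dir_deriv (axis j 1) (dir_deriv (axis i 1) ?Q) y * y $ i * y $ j) = 0"
    by (simp add: sum_distrib_left mult_ac)
  moreover have "0 < (\<Sum>i\<in>UNIV. \<Sum>j\<in>UNIV. dir_deriv (axis j 1) (dir_deriv (axis i 1) ?Q) y * y $ i * y $ j)"
    using assms unfolding minkowski_norm_def by blast
  ultimately show False by (subst (asm) sum.swap) simp
qed

text \<open>
  The situation in natural coordinates: over the coordinate domain \<open>U\<close>, the Finsler structure \<open>L\<close>
  is given by a single Minkowski norm \<open>\<Phi>\<close> on the fibres.
\<close>

locale constant_norm =
  fixes \<Phi> :: "real^'d \<Rightarrow> real" and L :: "(real^'d) \<times> (real^'d) \<Rightarrow> real" and U :: "(real^'d) set"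
  assumes minkowski: "minkowski_norm \<Phi>"
    and open_base: "open U"
    and norm_constant: "z \<in> U \<times> (- {0}) \<Longrightarrow> L z = \<Phi> (snd z)"
begin

definition fibre_metric :: "'d \<Rightarrow> 'd \<Rightarrow> real^'d \<Rightarrow> real" where
  "fibre_metric i j = dir_deriv (axis j 1) (dir_deriv (axis i 1) (\<lambda>y. (\<Phi> y)\<^sup>2 / 2))"

abbreviation slit_domain :: "((real^'d) \<times> (real^'d)) set" where "slit_domain \<equiv> U \<times> (- {0})"

lemma open_slit_domain: "open slit_domain"
  by (intro open_Times open_base) auto

lemma slit_domain_nonzero: "z \<in> slit_domain \<Longrightarrow> snd z \<noteq> 0"
  by auto

lemma smooth_energy: "smooth_on (- {0}) (\<lambda>y. (\<Phi> y)\<^sup>2 / 2)"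
  using minkowski unfolding minkowski_norm_def by (intro smooth_half_square) auto

lemma fibre_metric_differentiable: "y \<noteq> 0 \<Longrightarrow> fibre_metric i j differentiable at y"
  unfolding fibre_metric_def
  by (rule smooth_on_differentiable[OF smooth_on_dir_deriv[OF smooth_on_dir_deriv[OF smooth_energy]]]) simp

lemma fund_tensor_eq:
  assumes "z \<in> slit_domain"
  shows "fund_tensor L i j z = fibre_metric i j (snd z)"
proof -
  have "partial_y i (\<lambda>z. (L z)\<^sup>2 / 2) z = dir_deriv (axis i 1) (\<lambda>y. (\<Phi> y)\<^sup>2 / 2) (snd z)"
    if "z \<in> slit_domain" for z
    unfolding partial_y_def
    using dir_deriv_of_linear[OF bounded_linear_snd open_slit_domain that, of "\<lambda>z. (L z)\<^sup>2 / 2" "\<lambda>y. (\<Phi> y)\<^sup>2 / 2"]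
      smooth_on_differentiable[OF smooth_energy, of "snd z"] norm_constant slit_domain_nonzero[OF that]
    by simp
  then have "dir_deriv (0, axis j 1) (partial_y i (\<lambda>z. (L z)\<^sup>2 / 2)) z
      = dir_deriv (snd (0 :: real^'d, axis j 1)) (dir_deriv (axis i 1) (\<lambda>y. (\<Phi> y)\<^sup>2 / 2)) (snd z)"
    by (intro dir_deriv_of_linear[OF bounded_linear_snd open_slit_domain assms]
        smooth_on_differentiable[OF smooth_on_dir_deriv[OF smooth_energy]])
      (use slit_domain_nonzero[OF assms] in auto)
  then show ?thesis
    unfolding fund_tensor_def fibre_metric_def partial_y_def by simp
qed

lemma dir_deriv_fund_tensor:
  assumes "z \<in> slit_domain"
  shows "dir_deriv w (fund_tensor L i j) z = dir_deriv (snd w) (fibre_metric i j) (snd z)"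
proof (rule dir_deriv_of_linear[OF bounded_linear_snd open_slit_domain assms])
  show "fibre_metric i j differentiable at (snd z)"
    using fibre_metric_differentiable[OF slit_domain_nonzero[OF assms]] .
qed (rule fund_tensor_eq)

lemma nonlinear_connection_zero:
  assumes "z \<in> slit_domain"
  shows "nonlinear_connection L i j z = 0"
proof -
  have "partial_x k (fund_tensor L r s) z = 0" if "z \<in> slit_domain" for k r s z
    using dir_deriv_fund_tensor[OF that, of "(axis k 1, 0)" r s]
      linear_0[OF bounded_linear.linear[OF dir_deriv_linear[OF
          fibre_metric_differentiable[OF slit_domain_nonzero[OF that], of r s]]]]
    unfolding partial_x_def by simp
  then have "spray L i z = 0" if "z \<in> slit_domain" for z
    using that unfolding spray_def formal_christoffel_def by simp
  then show ?thesis
    using dir_deriv_cong[OF open_slit_domain assms, of "spray L i" "\<lambda>_. 0"]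
    unfolding nonlinear_connection_def partial_y_def by simp
qed

text \<open>
  As the fundamental tensor depends on \<open>y\<close> only, its differential is its fibre derivative; this is
  what the Cartan tensor encodes, because \<open>\<delta>y\<^sup>s / F\<close> reduces to \<open>dy\<^sup>s / F\<close>.
\<close>

lemma metric_compatible:
  assumes "z \<in> slit_domain"
  shows "2 * (\<Sum>s\<in>UNIV. cartan_tensor L i j s z * delta_y_over_F L s z w)
    = dir_deriv w (fund_tensor L i j) z"
proof -
  have y: "snd z \<noteq> 0" using assms by auto
  have nz: "L z \<noteq> 0" using minkowski_norm_pos[OF minkowski y] norm_constant[OF assms] by simp
  have "2 * (cartan_tensor L i j s z * delta_y_over_F L s z w)
      = (snd w $ s) *\<^sub>R dir_deriv (axis s 1) (fibre_metric i j) (snd z)" for s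
    using nz dir_deriv_fund_tensor[OF assms, of "(0, axis s 1)" i j]
    by (simp add: cartan_tensor_def delta_y_over_F_def nonlinear_connection_zero[OF assms] partial_y_def)
  then have "2 * (\<Sum>s\<in>UNIV. cartan_tensor L i j s z * delta_y_over_F L s z w)
      = (\<Sum>s\<in>UNIV. (snd w $ s) *\<^sub>R dir_deriv (axis s 1) (fibre_metric i j) (snd z))"
    by (simp add: sum_distrib_left)
  then show ?thesis
    using dir_deriv_axes[OF fibre_metric_differentiable[OF y], of "snd w"] dir_deriv_fund_tensor[OF assms]
    by metis
qed

lemma fund_tensor_pos:
  assumes "z \<in> slit_domain" "w \<noteq> 0"
  shows "0 < (\<Sum>i\<in>UNIV. \<Sum>j\<in>UNIV. fund_tensor L i j z * w $ i * w $ j)"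
  using minkowski assms unfolding minkowski_norm_def
  by (auto simp: fund_tensor_eq[OF assms(1)] fibre_metric_def)

end


section \<open>The Chern connection in natural coordinates\<close>

locale smooth_manifold =
  fixes A :: "('m::{t2_space, second_countable_topology}, real^'d) chart set"
  assumes smooth_structure: "smooth_structure A"
begin

lemma topological_charts: "c \<in> A \<Longrightarrow> topological_chart c"
  using smooth_structure unfolding smooth_structure_def by blast

lemma chart_homeomorphism: "c \<in> A \<Longrightarrow> homeomorphism (fst c) (snd c ` fst c) (snd c) (chart_inv c)"
  using topological_charts unfolding topological_chart_def by blast

lemma open_domain: "c \<in> A \<Longrightarrow> open (fst c)"
  using topological_charts unfolding topological_chart_def by blast

lemma open_chart_map:
  assumes "c \<in> A" "open U" "U \<subseteq> fst c"
  shows "open (snd c ` U)"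
proof -
  have "openin (top_of_set (snd c ` fst c)) (snd c ` U)"
    using homeomorphism_imp_open_map[OF chart_homeomorphism[OF assms(1)]] assms open_openin open_subset
    by (metis openin_open_eq open_domain)
  then show ?thesis
    using topological_charts[OF assms(1)] unfolding topological_chart_def
    using openin_open_trans by blast
qed

sublocale smooth_atlas A
proof
  fix C C' assume C: "C \<in> A"
  show "inj_on (snd C) (fst C)"
    using chart_homeomorphism[OF C] by (metis homeomorphism_apply1 inj_on_inverseI)
  assume C': "C' \<in> A"
  show "open (snd C ` (fst C \<inter> fst C'))"
    using open_chart_map[OF C] open_domain[OF C] open_domain[OF C'] by blast
  show "compatible C C'"
    using smooth_structure C C' unfolding smooth_structure_def by blast
qed

sublocale slit: smooth_atlas "slit_atlas A"
  by (rule slit_smooth_atlas)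

lemma natural_constant_norm:
  assumes "finsler_structure A F" "natural_coordinates A F c" "p \<in> fst c"
  obtains \<Phi> where "constant_norm \<Phi> (coord_rep (slit_chart A c) F) (snd c ` fst c)"
proof -
  obtain \<Phi> where c: "c \<in> A" and \<Phi>: "\<And>p v. p \<in> fst c \<Longrightarrow> v \<in> tangent_space A p \<Longrightarrow> F (p, v) = \<Phi> (v c)"
    using assms(2) unfolding natural_coordinates_def by blast
  have eq: "F (q, tvec_of A c q y) = \<Phi> y" if "q \<in> fst c" for q y
    using \<Phi>[OF that tvec_of_tangent[OF c that]] c that by simp
  have "minkowski_norm (\<lambda>y. F (p, tvec_of A c p y))"
    using assms(1,3) c unfolding finsler_structure_def by blast
  then have "minkowski_norm \<Phi>" by (simp add: eq assms(3))
  moreover have "coord_rep (slit_chart A c) F z = \<Phi> (snd z)" if "z \<in> snd c ` fst c \<times> (- {0})" for z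
    using that by (elim image_times_nonzeroE) (simp add: coord_rep_slit[OF c] eq)
  ultimately show ?thesis
    using that open_chart_image[OF c] unfolding constant_norm_def by blast
qed

text \<open>
  By \<open>metric_compatible\<close> the two structure equations of the Chern connection become the hypotheses
  of \<open>torsion_free_metric_zero\<close>: the differential of the metric cancels against the Cartan term.
\<close>

lemma chern_form_natural_zero:
  assumes "finsler_structure A F" "chern_connection A F nabla" "natural_coordinates A F c"
    and "\<xi> \<in> slit_over A (fst c)" "\<zeta> \<in> tangent_space (slit_atlas A) \<xi>"
  shows "connection_form A nabla c i j \<xi> \<zeta> = 0"
proof -
  have c: "c \<in> A" using assms(3) unfolding natural_coordinates_def by blast
  have p: "fst \<xi> \<in> fst c" using assms(4) by (simp add: slit_over_def)
  obtain \<Phi> where "constant_norm \<Phi> (coord_rep (slit_chart A c) F) (snd c ` fst c)"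
    using natural_constant_norm[OF assms(1,3) p] .
  then interpret constant_norm \<Phi> "coord_rep (slit_chart A c) F" "snd c ` fst c" .
  let ?L = "coord_rep (slit_chart A c) F" and ?z = "snd (slit_chart A c) \<xi>"
  have \<xi>: "\<xi> \<in> fst (slit_chart A c)" using assms(4) by (simp add: slit_chart_domain)
  have C: "slit_chart A c \<in> slit_atlas A" using c by (simp add: slit_atlas_def)
  have "?z \<in> snd c ` (fst c \<inter> fst c) \<times> (- {0})"
    using slit_image[OF c, of "fst c"] assms(4) by blast
  then have z: "?z \<in> slit_domain" by simp
  show ?thesis
  proof (rule torsion_free_metric_zero[where T = "tangent_space (slit_atlas A) \<xi>"
        and g = "\<lambda>i j. fund_tensor ?L i j ?z" and dx = "\<lambda>\<zeta>. fst (\<zeta> (slit_chart A c))"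
        and \<theta> = "\<lambda>i j. connection_form A nabla c i j \<xi>"])
    show "0 < (\<Sum>i\<in>UNIV. \<Sum>j\<in>UNIV. fund_tensor ?L i j ?z * w $ i * w $ j)" if "w \<noteq> 0" for w
      by (rule fund_tensor_pos[OF z that])
    show "(\<Sum>j\<in>UNIV. fst (\<zeta> (slit_chart A c)) $ j * connection_form A nabla c i j \<xi> \<zeta>'
        - fst (\<zeta>' (slit_chart A c)) $ j * connection_form A nabla c i j \<xi> \<zeta>) = 0"
      if "\<zeta> \<in> tangent_space (slit_atlas A) \<xi>" "\<zeta>' \<in> tangent_space (slit_atlas A) \<xi>" for \<zeta> \<zeta>' i
      using assms(2) c \<xi> that unfolding chern_connection_def Let_def by blast
    show "(\<Sum>k\<in>UNIV. fund_tensor ?L k j ?z * connection_form A nabla c k i \<xi> \<zeta>)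
        + (\<Sum>k\<in>UNIV. fund_tensor ?L i k ?z * connection_form A nabla c k j \<xi> \<zeta>) = 0"
      if "\<zeta> \<in> tangent_space (slit_atlas A) \<xi>" for \<zeta> i j
    proof -
      have "dir_deriv (\<zeta> (slit_chart A c)) (fund_tensor ?L i j) ?z
          - (\<Sum>k\<in>UNIV. fund_tensor ?L k j ?z * connection_form A nabla c k i \<xi> \<zeta>)
          - (\<Sum>k\<in>UNIV. fund_tensor ?L i k ?z * connection_form A nabla c k j \<xi> \<zeta>)
          = 2 * (\<Sum>s\<in>UNIV. cartan_tensor ?L i j s ?z * delta_y_over_F ?L s ?z (\<zeta> (slit_chart A c)))"
        using assms(2) c \<xi> that unfolding chern_connection_def Let_def by blast
      then show ?thesis using metric_compatible[OF z] by simp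
    qed
    show "\<exists>\<zeta>\<in>tangent_space (slit_atlas A) \<xi>. fst (\<zeta> (slit_chart A c)) = a" for a
      using slit.tvec_of_tangent[OF C \<xi>, of "(a, 0)"] slit.tvec_of_self[OF C \<xi>, of "(a, 0)"]
      by (metis fst_conv)
  qed (rule assms(5))
qed

end


section \<open>Global vector fields with prescribed value\<close>

text \<open>
  The functions \<open>exp (-1/t) / t\<^sup>m\<close> on the positive half-line, extended by \<open>0\<close>.  The member \<open>m = 0\<close>
  is the standard non-analytic smooth function; the others are included because the family is
  closed under differentiation up to linear combinations.
\<close>

definition flat :: "nat \<Rightarrow> real \<Rightarrow> real" where
  "flat m t = (if t > 0 then exp (- 1 / t) / t ^ m else 0)"

lemma flat_tendsto_0: "(flat m \<longlongrightarrow> 0) (at 0)"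
proof (rule filterlim_split_at)
  show "(flat m \<longlongrightarrow> 0) (at_left 0)"
    by (rule tendsto_eventually) (auto simp: flat_def eventually_at_filter)
  have "((\<lambda>t. inverse t ^ m / exp (inverse t)) \<longlongrightarrow> 0) (at_right (0::real))"
    by (rule filterlim_compose[OF tendsto_power_div_exp_0 filterlim_inverse_at_top_right])
  then show "(flat m \<longlongrightarrow> 0) (at_right 0)"
    by (rule Lim_transform_eventually)
      (auto simp: flat_def eventually_at_filter exp_minus field_simps power_inverse)
qed

text \<open>
  At \<open>t = 0\<close> the difference quotient of \<open>flat m\<close> is \<open>flat (Suc m)\<close>, which tends to \<open>0\<close>.
\<close>

lemma flat_has_derivative:
  "(flat m has_real_derivative (flat (m + 2) t - real m * flat (Suc m) t)) (at t)"
proof -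
  consider "t > 0" | "t < 0" | "t = 0" by linarith
  then show ?thesis
  proof cases
    case 1
    have "((\<lambda>t. exp (- 1 / t) / t ^ m) has_real_derivative (flat (m + 2) t - real m * flat (Suc m) t)) (at t)"
    proof (rule DERIV_cong)
      have "((\<lambda>t. exp (- 1 / t)) has_real_derivative (exp (- 1 / t) / t\<^sup>2)) (at t)"
        using 1 by (auto intro!: derivative_eq_intros simp: power2_eq_square)
      then show "((\<lambda>t. exp (- 1 / t) / t ^ m) has_real_derivative
          (exp (- 1 / t) / t\<^sup>2 * t ^ m - exp (- 1 / t) * (real m * t ^ (m - Suc 0))) / (t ^ m * t ^ m)) (at t)"
        using 1 by (intro DERIV_divide DERIV_pow) auto
      show "(exp (- 1 / t) / t\<^sup>2 * t ^ m - exp (- 1 / t) * (real m * t ^ (m - Suc 0))) / (t ^ m * t ^ m)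
          = flat (m + 2) t - real m * flat (Suc m) t"
        using 1 by (cases m) (simp_all add: flat_def field_simps power2_eq_square)
    qed
    then show ?thesis
      by (rule has_field_derivative_transform_within_open[of _ _ _ "{0<..}"]) (use 1 in \<open>auto simp: flat_def\<close>)
  next
    case 2
    have "((\<lambda>t. 0) has_real_derivative 0) (at t)" by simp
    then have "(flat m has_real_derivative 0) (at t)"
      by (rule has_field_derivative_transform_within_open[of _ _ _ "{..<0}"]) (use 2 in \<open>auto simp: flat_def\<close>)
    then show ?thesis using 2 by (simp add: flat_def)
  next
    case 3
    have "((\<lambda>h. flat m h / h) \<longlongrightarrow> 0) (at 0)"
      by (rule Lim_transform_eventually[OF flat_tendsto_0[of "Suc m"]])
        (auto simp: flat_def eventually_at_filter)
    then have "(flat m has_real_derivative 0) (at 0)"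
      by (simp add: DERIV_def flat_def)
    then show ?thesis using 3 by (simp add: flat_def)
  qed
qed

lemma smooth_flat: "smooth_on UNIV (flat m)"
proof -
  have "Ck_on k UNIV (flat m)" for k
  proof (induction k arbitrary: m)
    case 0
    show ?case
      using flat_has_derivative DERIV_isCont by (fastforce intro: continuous_at_imp_continuous_on)
  next
    case (Suc k)
    show ?case
    proof (rule Ck_on_SucI)
      show "(flat m has_derivative (\<lambda>v. v *\<^sub>R (flat (m + 2) t + (- real m) *\<^sub>R flat (Suc m) t))) (at t)" for t
        using flat_has_derivative[of m t] unfolding has_field_derivative_def
        by (simp add: mult_commute_abs)
      show "Ck_on k UNIV (\<lambda>t. v *\<^sub>R (flat (m + 2) t + (- real m) *\<^sub>R flat (Suc m) t))" for v :: real
        by (intro Ck_on_linear_image[OF bounded_linear_scaleR_right] Ck_on_add Suc open_UNIV)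
    qed simp
  qed
  then show ?thesis by (simp add: smooth_on_def)
qed

lemma bump_function:
  fixes x0 :: "'a::euclidean_space"
  assumes "r > 0"
  obtains \<phi> :: "'a \<Rightarrow> real" where "smooth_on UNIV \<phi>" "\<phi> x0 = 1" "\<And>x. \<phi> x \<noteq> 0 \<Longrightarrow> x \<in> ball x0 r"
proof -
  let ?q = "\<lambda>x. r\<^sup>2 - (x - x0) \<bullet> (x - x0)"
  define \<phi> where "\<phi> x = flat 0 (?q x) / flat 0 (r\<^sup>2)" for x
  have pos: "flat 0 (r\<^sup>2) > 0" using assms by (simp add: flat_def)
  have "Ck_on k UNIV ?q" for k
  proof -
    have a: "Ck_on k UNIV (\<lambda>x. x + (- x0))"
      by (rule Ck_on_add[OF open_UNIV Ck_on_bounded_linear[OF bounded_linear_ident] Ck_on_const])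
    have b: "Ck_on k UNIV (\<lambda>x. (x + (- x0)) \<bullet> (x + (- x0)))"
      by (rule Ck_on_bilinear[OF bounded_bilinear_inner open_UNIV a a])
    show ?thesis
      using Ck_on_add[OF open_UNIV Ck_on_const[of k UNIV "r\<^sup>2"]
          Ck_on_linear_image[OF bounded_linear_minus[OF bounded_linear_ident] open_UNIV b]]
      by simp
  qed
  then have q: "smooth_on UNIV ?q" by (simp add: smooth_on_def)
  have "smooth_on UNIV (\<lambda>x. flat 0 (?q x))"
    by (rule smooth_on_compose[OF open_UNIV _ q smooth_flat]) auto
  from smooth_on_linear_image[OF bounded_linear_divide[of "flat 0 (r\<^sup>2)"] open_UNIV this]
  have "smooth_on UNIV \<phi>" by (simp add: \<phi>_def[abs_def])
  moreover have "\<phi> x0 = 1" using pos by (simp add: \<phi>_def)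
  moreover have "x \<in> ball x0 r" if "\<phi> x \<noteq> 0" for x
  proof -
    have "?q x > 0" using that by (auto simp: \<phi>_def flat_def split: if_splits)
    then have "(norm (x - x0))\<^sup>2 < r\<^sup>2" by (simp add: power2_norm_eq_inner)
    then show ?thesis using assms power_less_imp_less_base[of "norm (x - x0)" 2 r]
      by (simp add: dist_norm norm_minus_commute)
  qed
  ultimately show ?thesis using that by blast
qed

context smooth_manifold
begin

text \<open>
  Multiply the constant coordinate field \<open>y\<close> by a bump function.  The extension by zero is smooth
  because the image \<open>K\<close> of a closed ball is compact, hence closed in the Hausdorff space, so that
  the chart domain and the complement of \<open>K\<close> form an open cover.
\<close>

lemma vector_field_through:
  assumes c: "c \<in> A" and p: "p \<in> fst c"
  obtains X where "X \<in> vector_fields A UNIV" "X p c = y"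
proof -
  have "open (snd c ` fst c)" by (rule open_chart_image[OF c])
  then obtain r where r: "r > 0" "cball (snd c p) r \<subseteq> snd c ` fst c"
    using p open_contains_cball by (metis imageI)
  obtain \<phi> :: "real^'d \<Rightarrow> real" where \<phi>: "smooth_on UNIV \<phi>" "\<phi> (snd c p) = 1"
    "\<And>x. \<phi> x \<noteq> 0 \<Longrightarrow> x \<in> ball (snd c p) r"
    using bump_function[OF r(1), of "snd c p"] by blast
  define X where "X q = (if q \<in> fst c then tvec_of A c q (\<phi> (snd c q) *\<^sub>R y) else (\<lambda>_. 0))" for q
  define K where "K = chart_inv c ` cball (snd c p) r"
  have "continuous_on (cball (snd c p) r) (chart_inv c)"
    by (rule continuous_on_subset[OF homeomorphism_cont2[OF chart_homeomorphism[OF c]] r(2)])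
  then have "closed K"
    unfolding K_def by (intro compact_imp_closed compact_continuous_image compact_cball)
  have XT: "X q \<in> tangent_space A q" for q
    by (simp add: X_def tvec_of_tangent[OF c] tangent_space_zero)
  have X0: "X q = (\<lambda>_. 0)" if "q \<notin> K" for q
  proof (cases "q \<in> fst c")
    case True
    then have "snd c q \<notin> cball (snd c p) r" using that chart_inv_chart[OF c True] unfolding K_def by force
    then have "\<phi> (snd c q) = 0" using \<phi>(3)[of "snd c q"] by auto
    then have "X q c = 0" using True c by (simp add: X_def)
    then show ?thesis using tangent_nonzero[OF XT c True] by blast
  qed (simp add: X_def)
  have "X \<in> vector_fields A (fst c)"
  proof (rule vector_field_in_chart[OF c subset_refl open_chart_image[OF c] XT])
    have op: "open (snd c ` fst c)" by (rule open_chart_image[OF c])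
    have "smooth_on (snd c ` fst c) (\<lambda>x. \<phi> x *\<^sub>R y)"
      by (rule smooth_on_scaleR[OF op smooth_on_subset[OF \<phi>(1)] smooth_on_const]) auto
    then show "smooth_on (snd c ` fst c) (coord_rep c (\<lambda>p. X p c))"
      by (rule iffD1[OF smooth_on_cong[OF op], rotated]) (use c in \<open>auto simp: X_def\<close>)
  qed
  then have near: "smooth_on (snd c' ` (fst c \<inter> fst c')) (coord_rep c' (\<lambda>q. X q c'))" if "c' \<in> A" for c'
    using that unfolding vector_fields_def by blast
  have "X \<in> vector_fields A UNIV"
    unfolding vector_fields_def
  proof (intro CollectI conjI ballI XT)
    fix c' assume c': "c' \<in> A"
    have op: "open (snd c' ` (fst c' - K))"
      by (rule open_chart_map[OF c' open_Diff[OF open_domain[OF c'] \<open>closed K\<close>]]) auto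
    have far: "smooth_on (snd c' ` (fst c' - K)) (coord_rep c' (\<lambda>q. X q c'))"
      by (rule iffD1[OF smooth_on_cong[OF op] smooth_on_const[of _ 0]]) (use c' X0 in auto)
    have "K \<subseteq> fst c"
      using r(2) chart_inv_chart[OF c] unfolding K_def by auto
    then have "snd c' ` (UNIV \<inter> fst c') = snd c' ` (fst c \<inter> fst c') \<union> snd c' ` (fst c' - K)"
      by auto
    then show "smooth_on (snd c' ` (UNIV \<inter> fst c')) (coord_rep c' (\<lambda>q. X q c'))"
      using smooth_on_Un[OF _ op near[OF c'] far] open_overlap[OF c' c] by (simp add: Int_commute)
  qed
  moreover have "X p c = y" using c p \<phi>(2) by (simp add: X_def)
  ultimately show ?thesis using that by blast
qed

end


section \<open>Two-forms in coordinates\<close>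

context smooth_manifold
begin

lemma coord_field_tangent: "c \<in> A \<Longrightarrow> p \<in> fst c \<Longrightarrow> coord_field A c i p \<in> tangent_space A p"
  unfolding coord_field_def by (rule tvec_of_tangent)

lemma coord_field_self [simp]: "c \<in> A \<Longrightarrow> p \<in> fst c \<Longrightarrow> coord_field A c i p c = axis i 1"
  by (simp add: coord_field_def)

lemma coord_field_vector_field:
  assumes "c \<in> A" shows "coord_field A c i \<in> vector_fields A (fst c)"
proof (rule vector_field_in_chart[OF assms subset_refl open_chart_image[OF assms]
      coord_field_tangent[OF assms]])
  show "smooth_on (snd c ` fst c) (coord_rep c (\<lambda>p. coord_field A c i p c))"
    by (rule iffD1[OF smooth_on_cong[OF open_chart_image[OF assms]] smooth_on_const[of _ "axis i 1"]])
      (use assms in auto)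
qed

lemma tangent_expansion:
  assumes "u \<in> tangent_space A p" "c \<in> A" "p \<in> fst c"
  shows "u = (\<lambda>C. \<Sum>i\<in>UNIV. (u c $ i) *\<^sub>R coord_field A c i p C)"
proof (rule tangent_eqI[OF assms(1) _ assms(2,3)])
  show "(\<lambda>C. \<Sum>i\<in>UNIV. (u c $ i) *\<^sub>R coord_field A c i p C) \<in> tangent_space A p"
    by (intro tangent_space_sum tangent_space_scaleR coord_field_tangent assms)
  show "u c = (\<Sum>i\<in>UNIV. (u c $ i) *\<^sub>R coord_field A c i p c)"
    using assms by (simp add: sum_axis_vec)
qed

lemma form_skew:
  "two_form A \<omega> \<Longrightarrow> u \<in> tangent_space A p \<Longrightarrow> v \<in> tangent_space A p \<Longrightarrow> \<omega> p u v = - \<omega> p v u"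
  unfolding two_form_def by blast

lemma form_lincomb:
  assumes "two_form A \<omega>" "u \<in> tangent_space A p" "v \<in> tangent_space A p" "w \<in> tangent_space A p"
  shows "\<omega> p (\<lambda>C. a *\<^sub>R u C + b *\<^sub>R v C) w = a * \<omega> p u w + b * \<omega> p v w"
  using assms unfolding two_form_def by blast

lemma form_sum_left:
  assumes "two_form A \<omega>" "\<And>i. i \<in> I \<Longrightarrow> u i \<in> tangent_space A p" "w \<in> tangent_space A p"
  shows "\<omega> p (\<lambda>C. \<Sum>i\<in>I. a i *\<^sub>R u i C) w = (\<Sum>i\<in>I. a i * \<omega> p (u i) w)"
  using assms(2)
proof (induction I rule: infinite_finite_induct)
  case (insert i I)
  have "(\<lambda>C. \<Sum>i\<in>I. a i *\<^sub>R u i C) \<in> tangent_space A p"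
    by (intro tangent_space_sum tangent_space_scaleR insert.prems) auto
  from form_lincomb[OF assms(1) _ this assms(3), of "u i" "a i" 1]
  show ?case using insert by simp
qed (use form_lincomb[OF assms(1,3,3,3), of 0 0] in auto)

lemma form_expand_left:
  assumes "two_form A \<omega>" "u \<in> tangent_space A p" "v \<in> tangent_space A p" "c \<in> A" "p \<in> fst c"
  shows "\<omega> p u v = (\<Sum>i\<in>UNIV. u c $ i * \<omega> p (coord_field A c i p) v)"
  using form_sum_left[where I = UNIV and u = "\<lambda>i. coord_field A c i p" and a = "\<lambda>i. u c $ i",
      OF assms(1) coord_field_tangent[OF assms(4,5)] assms(3)]
  by (simp flip: tangent_expansion[OF assms(2,4,5)])

lemma form_expand_right:
  assumes "two_form A \<omega>" "u \<in> tangent_space A p" "v \<in> tangent_space A p" "c \<in> A" "p \<in> fst c"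
  shows "\<omega> p u v = (\<Sum>j\<in>UNIV. v c $ j * \<omega> p u (coord_field A c j p))"
  using form_expand_left[OF assms(1,3,2,4,5)] form_skew[OF assms(1-3)]
    form_skew[OF assms(1,2) coord_field_tangent[OF assms(4,5)]]
  by (simp add: sum_negf)

lemma form_expand:
  assumes "two_form A \<omega>" "u \<in> tangent_space A p" "v \<in> tangent_space A p" "c \<in> A" "p \<in> fst c"
  shows "\<omega> p u v = (\<Sum>i\<in>UNIV. \<Sum>j\<in>UNIV. u c $ i * v c $ j * form_comp A \<omega> c i j p)"
  using form_expand_left[OF assms]
    form_expand_right[OF assms(1) coord_field_tangent[OF assms(4,5)] assms(3,4,5)]
  by (simp add: form_comp_def sum_distrib_left mult.assoc)

lemma form_comp_differentiable:
  assumes "two_form A \<omega>" "c \<in> A" "p \<in> fst c"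
  shows "coord_rep c (form_comp A \<omega> c i j) differentiable at (snd c p)"
  by (rule smooth_on_differentiable[of "snd c ` fst c"]) (use assms in \<open>auto simp: two_form_def\<close>)

lemma dir_deriv_form_comp_zero:
  assumes "two_form A \<omega>" "c \<in> A" "p \<in> fst c" "\<And>k. coord_deriv c k (form_comp A \<omega> c i j) p = 0"
  shows "dir_deriv v (coord_rep c (form_comp A \<omega> c i j)) (snd c p) = 0"
  using dir_deriv_axes[OF form_comp_differentiable[OF assms(1-3)], of v] assms(4)
  by (simp add: coord_deriv_def)

end


section \<open>Preservation of a two-form by the Chern connection\<close>

text \<open>
  The base part of a coordinate change of the slit tangent bundle does not involve the fibre
  variable, so the base components of a tangent vector of the bundle transform among themselves.
\<close>

lemma (in smooth_atlas) d_proj_tangent: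
  assumes "\<xi> \<in> slit_bundle B" "\<zeta> \<in> tangent_space (slit_atlas B) \<xi>"
  shows "d_proj B \<xi> \<zeta> \<in> tangent_space B (fst \<xi>)"
  unfolding tangent_space_def
proof (intro CollectI conjI ballI impI allI)
  interpret slit: smooth_atlas "slit_atlas B" by (rule slit_smooth_atlas)
  fix C C' assume C: "C \<in> B" "C' \<in> B" and p: "fst \<xi> \<in> fst C \<inter> fst C'"
  let ?D = "slit_chart B C" and ?D' = "slit_chart B C'" and ?z = "snd (slit_chart B C) \<xi>"
  have D: "?D \<in> slit_atlas B" "?D' \<in> slit_atlas B" using C by (auto simp: slit_atlas_def)
  have \<xi>: "\<xi> \<in> fst ?D" "\<xi> \<in> fst ?D'" using assms(1) p by (auto simp: slit_chart_domain slit_over_def)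
  let ?S = "snd C ` (fst C \<inter> fst C') \<times> (- {0 :: 'e})"
  have op: "open ?S" by (intro open_Times open_overlap C) auto
  have "?z \<in> snd C ` (fst C' \<inter> fst C) \<times> (- {0})"
    using slit_image[OF C(1), of "fst C'"] \<xi> unfolding slit_chart_domain by blast
  then have z: "?z \<in> ?S" by (simp add: Int_commute)
  have "fst (\<zeta> ?D') = fst (dir_deriv (\<zeta> ?D) (coord_rep ?D (snd ?D')) ?z)"
    using slit.tangent_change[OF assms(2) D \<xi>] by simp
  also have "\<dots> = dir_deriv (\<zeta> ?D) (\<lambda>z. fst (coord_rep ?D (snd ?D') z)) ?z"
    using dir_deriv_eq[OF bounded_linear.has_derivative[OF bounded_linear_fst
          has_derivative_dir_deriv[OF slit.change_differentiable[OF D \<xi>]]]] by simp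
  also have "\<dots> = dir_deriv (fst (\<zeta> ?D)) (coord_rep C (snd C')) (fst ?z)"
  proof (rule dir_deriv_of_linear[OF bounded_linear_fst op z])
    show "fst (coord_rep ?D (snd ?D') z) = coord_rep C (snd C') (fst z)" if "z \<in> ?S" for z
      using slit_change[OF C that] by simp
    show "coord_rep C (snd C') differentiable at (fst ?z)"
      using change_differentiable[OF C] p by simp
  qed
  finally show "d_proj B \<xi> \<zeta> C' = dir_deriv (d_proj B \<xi> \<zeta> C) (coord_rep C (snd C')) (snd C (fst \<xi>))"
    using C p by (simp add: d_proj_def)
qed (auto simp: d_proj_def)

context smooth_manifold
begin

lemma vector_field_tangent: "X \<in> vector_fields A UNIV \<Longrightarrow> X p \<in> tangent_space A p"
  unfolding vector_fields_def by blast

lemma vector_field_smooth: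
  "X \<in> vector_fields A UNIV \<Longrightarrow> c \<in> A \<Longrightarrow> smooth_on (snd c ` fst c) (coord_rep c (\<lambda>p. X p c))"
  unfolding vector_fields_def by auto

lemma vector_field_restrict:
  assumes "X \<in> vector_fields A UNIV" "c \<in> A" shows "X \<in> vector_fields A (fst c)"
  by (rule vector_field_in_chart[OF assms(2) subset_refl open_chart_image[OF assms(2)]])
    (use assms vector_field_tangent vector_field_smooth in blast)+

text \<open>
  Expanding \<open>X\<close> in the coordinate frame, whose covariant derivatives vanish, leaves only the
  derivatives of the components.  The expansion holds just over the chart domain, so locality of the
  connection is needed to replace the lift of \<open>X\<close> by it.
\<close>

lemma chern_derivative_natural:
  assumes fin: "finsler_structure A F" and ch: "chern_connection A F nabla"
    and nat: "natural_coordinates A F c"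
    and \<xi>: "\<xi> \<in> slit_over A (fst c)" and \<zeta>: "\<zeta> \<in> tangent_space (slit_atlas A) \<xi>"
    and X: "X \<in> vector_fields A UNIV"
  shows "nabla \<xi> \<zeta> (lift_field X) \<in> tangent_space A (fst \<xi>)"
    and "nabla \<xi> \<zeta> (lift_field X) c
      = dir_deriv (fst (\<zeta> (slit_chart A c))) (coord_rep c (\<lambda>p. X p c)) (snd c (fst \<xi>))"
proof -
  have c: "c \<in> A" using nat unfolding natural_coordinates_def by blast
  have p: "fst \<xi> \<in> fst c" using \<xi> by (simp add: slit_over_def)
  have lin: "linear_connection A nabla" using ch unfolding chern_connection_def by blast
  let ?D = "slit_chart A c" and ?W = "slit_over A (fst c)"
  have D: "?D \<in> slit_atlas A" "\<xi> \<in> fst ?D" using c \<xi> by (auto simp: slit_atlas_def slit_chart_domain)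
  have opU: "manifold_open A (fst c)" by (rule manifold_open_in_chart[OF c subset_refl open_chart_image[OF c]])
  have opW: "manifold_open (slit_atlas A) ?W" by (rule manifold_open_slit_over[OF opU])
  have secX: "lift_field X \<in> pb_sections A ?W"
    by (rule lift_field_section[OF opU vector_field_restrict[OF X c]])
  show tan: "nabla \<xi> \<zeta> (lift_field X) \<in> tangent_space A (fst \<xi>)"
    by (rule connection_tangent[OF lin opW secX \<xi> \<zeta>])
  have sec: "lift_field (coord_field A c i) \<in> pb_sections A ?W" for i
    by (rule lift_field_section[OF opU coord_field_vector_field[OF c]])
  let ?Xc = "coord_rep c (\<lambda>p. X p c)" and ?a = "fst (\<zeta> ?D)"
  define f where "f i \<eta> = X (fst \<eta>) c $ i" for i and \<eta> :: "'m \<times> ('m, real^'d) tvec"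
  have smi: "smooth_on (snd c ` fst c) (coord_rep c (\<lambda>q. X q c $ i))" for i
    using smooth_on_linear_image[OF bounded_linear_vec_nth open_chart_image[OF c] vector_field_smooth[OF X c], of i]
    by (simp add: coord_rep_def comp_def)
  have smf: "smooth_fun (slit_atlas A) ?W (f i)" for i
    unfolding f_def[abs_def]
    by (rule smooth_fun_lift[OF opU smooth_fun_in_chart[OF c subset_refl open_chart_image[OF c] smi]])
  have vd: "vec_deriv (slit_atlas A) \<xi> \<zeta> (f i) = dir_deriv ?a ?Xc (snd c (fst \<xi>)) $ i" for i
  proof -
    have dX: "?Xc differentiable at (snd c (fst \<xi>))"
      by (rule smooth_on_differentiable[OF vector_field_smooth[OF X c]]) (use p in auto)
    have op: "open (snd c ` fst c \<times> (- {0 :: real^'d}))" by (intro open_Times open_chart_image[OF c]) auto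
    have z: "snd ?D \<xi> \<in> snd c ` fst c \<times> (- {0})"
      using slit_image[OF c, of "fst c"] \<xi> by auto
    have sm: "smooth_on (snd ?D ` (?W \<inter> fst ?D)) (coord_rep ?D (f i))"
      using smf[of i] D unfolding smooth_fun_def by blast
    have "vec_deriv (slit_atlas A) \<xi> \<zeta> (f i) = dir_deriv (\<zeta> ?D) (coord_rep ?D (f i)) (snd ?D \<xi>)"
      by (rule slit.vec_deriv_eq[OF \<zeta> D smooth_on_differentiable[OF sm]]) (use \<xi> D in blast)
    also have "\<dots> = dir_deriv ?a (coord_rep c (\<lambda>q. X q c $ i)) (fst (snd ?D \<xi>))"
    proof (rule dir_deriv_of_linear[OF bounded_linear_fst op z])
      show "coord_rep ?D (f i) z = coord_rep c (\<lambda>q. X q c $ i) (fst z)"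
        if "z \<in> snd c ` fst c \<times> (- {0})" for z
        unfolding f_def[abs_def] by (rule coord_rep_slit_lift[OF c that])
      show "coord_rep c (\<lambda>q. X q c $ i) differentiable at (fst (snd ?D \<xi>))"
        by (rule smooth_on_differentiable[OF smi]) (use p in auto)
    qed
    also have "\<dots> = dir_deriv ?a ?Xc (snd c (fst \<xi>)) $ i"
      using dir_deriv_vec_nth[OF dX, of ?a i] by (simp add: coord_rep_def comp_def)
    finally show ?thesis .
  qed
  have frame: "nabla \<xi> \<zeta> (lift_field (coord_field A c i)) c = 0" for i
    using chern_form_natural_zero[OF fin ch nat \<xi> \<zeta>] by (simp add: connection_form_def vec_eq_iff)
  have "nabla \<xi> \<zeta> (lift_field X)
      = nabla \<xi> \<zeta> (\<lambda>\<eta> C. \<Sum>i\<in>UNIV. f i \<eta> *\<^sub>R lift_field (coord_field A c i) \<eta> C)"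
  proof (rule connection_local[OF lin opW secX pb_sections_sum[OF opW sec smf] \<xi> \<zeta>])
    show "lift_field X \<eta> = (\<lambda>C. \<Sum>i\<in>UNIV. f i \<eta> *\<^sub>R lift_field (coord_field A c i) \<eta> C)" if "\<eta> \<in> ?W" for \<eta>
      using tangent_expansion[OF vector_field_tangent[OF X] c, of "fst \<eta>"] that
      by (simp add: f_def lift_field_def slit_over_def)
  qed
  also have "\<dots> = (\<lambda>C. \<Sum>i\<in>UNIV. vec_deriv (slit_atlas A) \<xi> \<zeta> (f i) *\<^sub>R lift_field (coord_field A c i) \<xi> C
      + f i \<xi> *\<^sub>R nabla \<xi> \<zeta> (lift_field (coord_field A c i)) C)"
    by (rule connection_sum[OF lin opW sec smf \<xi> \<zeta>])
  finally show "nabla \<xi> \<zeta> (lift_field X) c = dir_deriv ?a ?Xc (snd c (fst \<xi>))"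
    using p c by (simp add: vd frame[unfolded lift_field_def] lift_field_def sum_axis_vec)
qed

text \<open>
  Differentiate \<open>\<omega>(X, Y) = \<Sum> X\<^sup>i Y\<^sup>j \<omega>\<^sub>i\<^sub>j\<close> by the product rule.  The terms in which a component of \<open>X\<close>
  or \<open>Y\<close> is differentiated are those of the covariant derivatives; the rest, which is the failure of
  the connection to preserve \<open>\<omega>\<close>, is tensorial in \<open>X\<close>, \<open>Y\<close> and \<open>Z\<close>.
\<close>

lemma preservation_defect:
  assumes fin: "finsler_structure A F" and ch: "chern_connection A F nabla" and \<omega>: "two_form A \<omega>"
    and nat: "natural_coordinates A F c"
    and \<xi>: "\<xi> \<in> slit_over A (fst c)" and \<zeta>: "\<zeta> \<in> tangent_space (slit_atlas A) \<xi>"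
    and X: "X \<in> vector_fields A UNIV" and Y: "Y \<in> vector_fields A UNIV" and Z: "Z \<in> vector_fields A UNIV"
    and proj: "d_proj A \<xi> \<zeta> = Z (fst \<xi>)"
  shows "vec_deriv A (fst \<xi>) (Z (fst \<xi>)) (\<lambda>p. \<omega> p (X p) (Y p))
      = lift_form \<omega> \<xi> (nabla \<xi> \<zeta> (lift_field X)) (lift_field Y \<xi>)
        + lift_form \<omega> \<xi> (lift_field X \<xi>) (nabla \<xi> \<zeta> (lift_field Y))
      + (\<Sum>i\<in>UNIV. \<Sum>j\<in>UNIV. X (fst \<xi>) c $ i * Y (fst \<xi>) c $ j
          * dir_deriv (Z (fst \<xi>) c) (coord_rep c (form_comp A \<omega> c i j)) (snd c (fst \<xi>)))"
proof -
  define p where "p = fst \<xi>"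
  have c: "c \<in> A" using nat unfolding natural_coordinates_def by blast
  have p: "p \<in> fst c" using \<xi> by (simp add: slit_over_def p_def)
  have a: "Z p c = fst (\<zeta> (slit_chart A c))"
    using fun_cong[OF proj, of c] c p by (simp add: d_proj_def p_def)
  note T = vector_field_tangent[OF X, of p] vector_field_tangent[OF Y, of p] vector_field_tangent[OF Z, of p]
  note nX = chern_derivative_natural[OF fin ch nat \<xi> \<zeta> X, folded p_def a]
  note nY = chern_derivative_natural[OF fin ch nat \<xi> \<zeta> Y, folded p_def a]
  let ?X = "coord_rep c (\<lambda>p. X p c)" and ?Y = "coord_rep c (\<lambda>p. Y p c)"
  let ?w = "\<lambda>i j. coord_rep c (form_comp A \<omega> c i j)" and ?x = "snd c p"
  have dX: "?X differentiable at ?x" and dY: "?Y differentiable at ?x"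
    by (rule smooth_on_differentiable[OF vector_field_smooth[OF X c]] smooth_on_differentiable[OF vector_field_smooth[OF Y c]],
        use p in auto)+
  note d = has_derivative_dir_deriv[OF dX] has_derivative_dir_deriv[OF dY]
    has_derivative_dir_deriv[OF form_comp_differentiable[OF \<omega> c p]]
  let ?h = "\<lambda>x. \<Sum>i\<in>UNIV. \<Sum>j\<in>UNIV. ?X x $ i * ?Y x $ j * ?w i j x"
  have eq: "?h x = coord_rep c (\<lambda>p. \<omega> p (X p) (Y p)) x" if "x \<in> snd c ` fst c" for x
    using that c form_expand[OF \<omega> vector_field_tangent[OF X] vector_field_tangent[OF Y] c] by auto
  have hd: "(?h has_derivative (\<lambda>v. \<Sum>i\<in>UNIV. \<Sum>j\<in>UNIV.
      ?X ?x $ i * ?Y ?x $ j * dir_deriv v (?w i j) ?x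
      + (?X ?x $ i * dir_deriv v ?Y ?x $ j + dir_deriv v ?X ?x $ i * ?Y ?x $ j) * ?w i j ?x)) (at ?x)"
    by (intro has_derivative_sum has_derivative_mult bounded_linear.has_derivative[OF bounded_linear_vec_nth] d)
  have px: "?x \<in> snd c ` fst c" using p by blast
  have "vec_deriv A p (Z p) (\<lambda>p. \<omega> p (X p) (Y p)) = dir_deriv (Z p c) (coord_rep c (\<lambda>p. \<omega> p (X p) (Y p))) ?x"
    by (rule vec_deriv_eq[OF T(3) c p differentiable_cong[OF open_chart_image[OF c] px eq]])
      (use hd in \<open>auto simp: differentiable_def\<close>)
  also have "\<dots> = dir_deriv (Z p c) ?h ?x"
    by (rule dir_deriv_cong[OF open_chart_image[OF c] px eq[symmetric]])
  also have "\<dots> = (\<Sum>i\<in>UNIV. \<Sum>j\<in>UNIV. X p c $ i * Y p c $ j * dir_deriv (Z p c) (?w i j) ?x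
      + (X p c $ i * dir_deriv (Z p c) ?Y ?x $ j + dir_deriv (Z p c) ?X ?x $ i * Y p c $ j) * form_comp A \<omega> c i j p)"
    using dir_deriv_eq[OF hd, of "Z p c"] c p by simp
  also have "\<dots> = \<omega> p (nabla \<xi> \<zeta> (lift_field X)) (Y p) + \<omega> p (X p) (nabla \<xi> \<zeta> (lift_field Y))
      + (\<Sum>i\<in>UNIV. \<Sum>j\<in>UNIV. X p c $ i * Y p c $ j * dir_deriv (Z p c) (?w i j) ?x)"
    unfolding form_expand[OF \<omega> nX(1) T(2) c p] form_expand[OF \<omega> T(1) nY(1) c p] nX(2) nY(2)
    by (simp add: sum.distrib algebra_simps)
  finally show ?thesis by (simp add: lift_form_def lift_field_def flip: p_def)
qed

text \<open>
  The defect computed in \<open>preservation_defect\<close> vanishes for constant components.  Conversely, its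
  value at vector fields through the coordinate vectors at \<open>p\<close> is one of the derivatives
  \<open>\<partial>\<^sub>k \<omega>\<^sub>i\<^sub>j\<close>.  Any nonzero tangent vector at \<open>p\<close> can serve as the point \<open>\<xi>\<close> over \<open>p\<close>; the coordinate
  vector \<open>\<partial>\<^sub>k\<close> is one.
\<close>

lemma preserves_form_iff_constant:
  assumes fin: "finsler_structure A F" and ch: "chern_connection A F nabla" and \<omega>: "two_form A \<omega>"
    and loc: "locally_minkowskian A F"
  shows "preserves_form A nabla \<omega> \<longleftrightarrow>
    (\<forall>c. natural_coordinates A F c \<longrightarrow>
      (\<forall>i j k. \<forall>p\<in>fst c. coord_deriv c k (form_comp A \<omega> c i j) p = 0))"
proof (intro iffI allI impI ballI)
  fix c i j k p assume pres: "preserves_form A nabla \<omega>" and nat: "natural_coordinates A F c" and p: "p \<in> fst c"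
  have c: "c \<in> A" using nat unfolding natural_coordinates_def by blast
  obtain X where X: "X \<in> vector_fields A UNIV" "X p c = axis i 1" by (rule vector_field_through[OF c p])
  obtain Y where Y: "Y \<in> vector_fields A UNIV" "Y p c = axis j 1" by (rule vector_field_through[OF c p])
  obtain Z where Z: "Z \<in> vector_fields A UNIV" "Z p c = axis k 1" by (rule vector_field_through[OF c p])
  define \<xi> where "\<xi> = (p, tvec_of A c p (axis k 1))"
  have \<xi>0: "\<xi> \<in> slit_bundle A" unfolding \<xi>_def by (rule slit_point[OF c p]) (simp add: axis_eq_0_iff)
  then have \<xi>: "\<xi> \<in> slit_over A (fst c)" using p by (simp add: slit_over_def \<xi>_def)
  let ?D = "slit_chart A c"
  have D: "?D \<in> slit_atlas A" "\<xi> \<in> fst ?D" using c \<xi> by (auto simp: slit_atlas_def slit_chart_domain)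
  define \<zeta> where "\<zeta> = tvec_of (slit_atlas A) ?D \<xi> (axis k 1, 0)"
  have \<zeta>: "\<zeta> \<in> tangent_space (slit_atlas A) \<xi>" "\<zeta> ?D = (axis k 1, 0)"
    unfolding \<zeta>_def by (rule slit.tvec_of_tangent[OF D]) (rule slit.tvec_of_self[OF D])
  have proj: "d_proj A \<xi> \<zeta> = Z (fst \<xi>)"
  proof (rule tangent_eqI[OF d_proj_tangent[OF \<xi>0 \<zeta>(1)] vector_field_tangent[OF Z(1)] c])
    show "d_proj A \<xi> \<zeta> c = Z (fst \<xi>) c"
      using c p \<zeta>(2) Z(2) by (simp add: d_proj_def \<xi>_def)
  qed (simp add: \<xi>_def p)
  have "vec_deriv A (fst \<xi>) (Z (fst \<xi>)) (\<lambda>p. \<omega> p (X p) (Y p))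
        = lift_form \<omega> \<xi> (nabla \<xi> \<zeta> (lift_field X)) (lift_field Y \<xi>)
          + lift_form \<omega> \<xi> (lift_field X \<xi>) (nabla \<xi> \<zeta> (lift_field Y))"
    using pres X(1) Y(1) Z(1) \<xi>0 \<zeta>(1) proj unfolding preserves_form_def by blast
  with preservation_defect[OF fin ch \<omega> nat \<xi> \<zeta>(1) X(1) Y(1) Z(1) proj]
  have "(\<Sum>i'\<in>UNIV. \<Sum>j'\<in>UNIV. axis i 1 $ i' * axis j 1 $ j'
          * dir_deriv (axis k 1) (coord_rep c (form_comp A \<omega> c i' j')) (snd c p)) = 0"
    using X(2) Y(2) Z(2) by (simp add: \<xi>_def)
  then show "coord_deriv c k (form_comp A \<omega> c i j) p = 0"
    by (simp add: axis_def coord_deriv_def if_distrib[of "\<lambda>x. x * _"] if_distrib[of "\<lambda>x. _ * x"] cong: if_cong)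
next
  assume const: "\<forall>c. natural_coordinates A F c \<longrightarrow>
      (\<forall>i j k. \<forall>p\<in>fst c. coord_deriv c k (form_comp A \<omega> c i j) p = 0)"
  show "preserves_form A nabla \<omega>"
    unfolding preserves_form_def
  proof (intro ballI impI)
    fix X Y Z \<xi> \<zeta>
    assume X: "X \<in> vector_fields A UNIV" and Y: "Y \<in> vector_fields A UNIV" and Z: "Z \<in> vector_fields A UNIV"
      and \<xi>: "\<xi> \<in> slit_bundle A" and \<zeta>: "\<zeta> \<in> tangent_space (slit_atlas A) \<xi>"
      and proj: "d_proj A \<xi> \<zeta> = Z (fst \<xi>)"
    obtain c where nat: "natural_coordinates A F c" and p: "fst \<xi> \<in> fst c"
      using loc unfolding locally_minkowskian_def by blast
    have c: "c \<in> A" using nat unfolding natural_coordinates_def by blast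
    have \<xi>': "\<xi> \<in> slit_over A (fst c)" using \<xi> p by (simp add: slit_over_def)
    have "dir_deriv v (coord_rep c (form_comp A \<omega> c i j)) (snd c (fst \<xi>)) = 0" for v i j
      using const nat p by (intro dir_deriv_form_comp_zero[OF \<omega> c p]) blast
    then show "vec_deriv A (fst \<xi>) (Z (fst \<xi>)) (\<lambda>p. \<omega> p (X p) (Y p))
        = lift_form \<omega> \<xi> (nabla \<xi> \<zeta> (lift_field X)) (lift_field Y \<xi>)
          + lift_form \<omega> \<xi> (lift_field X \<xi>) (nabla \<xi> \<zeta> (lift_field Y))"
      using preservation_defect[OF fin ch \<omega> nat \<xi>' \<zeta> X Y Z proj] by simp
  qed
qed

end


section \<open>Forms with constant components in other coordinates\<close>

context smooth_manifold
begin

text \<open>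
  The components in the two charts are related by \<open>\<omega>'\<^sub>i\<^sub>j = \<Sum> \<omega>\<^sub>a\<^sub>b J\<^sub>i\<^sup>a J\<^sub>j\<^sup>b\<close>, where \<open>J\<^sub>i\<close> is the
  vector of derivatives \<open>\<partial>'\<^sub>i x\<close>.
  Since the derivatives of \<open>\<omega>\<^sub>a\<^sub>b\<close> vanish at \<open>p\<close>, only the second derivatives \<open>K\<^sub>i = \<partial>'\<^sub>k J\<^sub>i\<close> contribute
  to \<open>\<partial>'\<^sub>k \<omega>'\<^sub>i\<^sub>j\<close>.  The sums over \<open>l\<close> in the claim are the mixed components \<open>\<omega>(\<partial>\<^sub>h, \<partial>'\<^sub>j)\<close> and
  \<open>\<omega>(\<partial>'\<^sub>i, \<partial>\<^sub>h)\<close>, because \<open>\<partial>\<^sub>h = \<Sum> (\<partial>\<^sub>h x'\<^sup>l) \<partial>'\<^sub>l\<close>.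
\<close>

lemma constant_form_change:
  assumes \<omega>: "two_form A \<omega>" and c: "c \<in> A" and c': "c' \<in> A" and p: "p \<in> fst c \<inter> fst c'"
    and const: "\<And>a b k. coord_deriv c k (form_comp A \<omega> c a b) p = 0"
  shows "(\<Sum>h\<in>UNIV. \<Sum>l\<in>UNIV.
             coord_deriv c h (\<lambda>q. snd c' q $ l) p
             * coord_deriv c' k (coord_deriv c' i (\<lambda>q. snd c q $ h)) p
             * form_comp A \<omega> c' l j p)
          + (\<Sum>h\<in>UNIV. \<Sum>l\<in>UNIV.
             coord_deriv c h (\<lambda>q. snd c' q $ l) p
             * coord_deriv c' k (coord_deriv c' j (\<lambda>q. snd c q $ h)) p
             * form_comp A \<omega> c' i l p)
          = coord_deriv c' k (form_comp A \<omega> c' i j) p"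
proof -
  let ?O = "snd c' ` (fst c' \<inter> fst c)" and ?x = "snd c' p" and ?\<tau> = "coord_rep c' (snd c)"
  have pc: "p \<in> fst c" "p \<in> fst c'" using p by auto
  have opO: "open ?O" by (rule open_overlap[OF c' c])
  have xO: "?x \<in> ?O" using p by blast
  define J where "J i = dir_deriv (axis i 1) ?\<tau>" for i
  define K where "K i = dir_deriv (axis k 1) (J i) ?x" for i
  have smJ: "smooth_on ?O (J i)" for i
    unfolding J_def by (rule smooth_on_dir_deriv[OF smooth_change[OF c' c]])
  have dJ: "J i differentiable at ?x" for i by (rule smooth_on_differentiable[OF smJ xO])
  have field: "coord_field A c' i q c = J i (snd c' q)" if "q \<in> fst c" "q \<in> fst c'" for i q
    using that c by (simp add: coord_field_def tvec_of_def J_def)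
  note T = coord_field_tangent[OF c pc(1)] coord_field_tangent[OF c' pc(2)]
  have second: "coord_deriv c' k (coord_deriv c' i (\<lambda>q. snd c q $ h)) p = K i $ h" for i h
  proof -
    have "coord_rep c' (coord_deriv c' i (\<lambda>q. snd c q $ h)) y = J i y $ h" if y: "y \<in> ?O" for y
    proof -
      have "?\<tau> differentiable at y" by (rule smooth_on_differentiable[OF smooth_change[OF c' c] y])
      then have "dir_deriv (axis i 1) (coord_rep c' (\<lambda>q. snd c q $ h)) y = J i y $ h"
        using dir_deriv_vec_nth[of ?\<tau> y "axis i 1" h] by (simp add: J_def coord_rep_def comp_def)
      then show ?thesis using y c' by (auto simp: coord_deriv_def)
    qed
    then have "coord_deriv c' k (coord_deriv c' i (\<lambda>q. snd c q $ h)) p = dir_deriv (axis k 1) (\<lambda>y. J i y $ h) ?x"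
      unfolding coord_deriv_def[of c' k] by (intro dir_deriv_cong[OF opO xO])
    then show ?thesis using dir_deriv_vec_nth[OF dJ] by (simp add: K_def)
  qed
  have first: "coord_deriv c h (\<lambda>q. snd c' q $ l) p = coord_field A c h p c' $ l" for h l
    using dir_deriv_vec_nth[OF change_differentiable[OF c c' pc], of "axis h 1" l] c' pc
    by (simp add: coord_deriv_def coord_field_def tvec_of_def coord_rep_def comp_def)
  have left: "(\<Sum>h\<in>UNIV. \<Sum>l\<in>UNIV. coord_deriv c h (\<lambda>q. snd c' q $ l) p
      * coord_deriv c' k (coord_deriv c' i (\<lambda>q. snd c q $ h)) p * form_comp A \<omega> c' l j p)
    = (\<Sum>a\<in>UNIV. \<Sum>b\<in>UNIV. K i $ a * J j ?x $ b * form_comp A \<omega> c a b p)" for i j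
  proof (rule sum.cong[OF refl])
    fix h
    have "(\<Sum>l\<in>UNIV. coord_deriv c h (\<lambda>q. snd c' q $ l) p
        * coord_deriv c' k (coord_deriv c' i (\<lambda>q. snd c q $ h)) p * form_comp A \<omega> c' l j p)
      = K i $ h * \<omega> p (coord_field A c h p) (coord_field A c' j p)"
      unfolding form_expand_left[OF \<omega> T c' pc(2)] first second
      by (simp add: form_comp_def sum_distrib_left mult_ac)
    then show "(\<Sum>l\<in>UNIV. coord_deriv c h (\<lambda>q. snd c' q $ l) p
        * coord_deriv c' k (coord_deriv c' i (\<lambda>q. snd c q $ h)) p * form_comp A \<omega> c' l j p)
      = (\<Sum>b\<in>UNIV. K i $ h * J j ?x $ b * form_comp A \<omega> c h b p)"
      unfolding form_expand_right[OF \<omega> T c pc(1)] field[OF pc]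
      by (simp add: form_comp_def sum_distrib_left mult_ac)
  qed
  have skew: "form_comp A \<omega> c' i l p = - form_comp A \<omega> c' l i p"
    "form_comp A \<omega> c i l p = - form_comp A \<omega> c l i p" for i l
    unfolding form_comp_def by (rule form_skew[OF \<omega>]; rule T)+
  \<comment> \<open>By skew symmetry, this is \<open>left\<close> with the two arguments of the form exchanged.\<close>
  have right: "(\<Sum>h\<in>UNIV. \<Sum>l\<in>UNIV. coord_deriv c h (\<lambda>q. snd c' q $ l) p
      * coord_deriv c' k (coord_deriv c' j (\<lambda>q. snd c q $ h)) p * form_comp A \<omega> c' i l p)
    = (\<Sum>a\<in>UNIV. \<Sum>b\<in>UNIV. J i ?x $ a * K j $ b * form_comp A \<omega> c a b p)"
  proof -
    have "(\<Sum>h\<in>UNIV. \<Sum>l\<in>UNIV. coord_deriv c h (\<lambda>q. snd c' q $ l) p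
      * coord_deriv c' k (coord_deriv c' j (\<lambda>q. snd c q $ h)) p * form_comp A \<omega> c' i l p)
      = - (\<Sum>b\<in>UNIV. \<Sum>a\<in>UNIV. K j $ b * J i ?x $ a * form_comp A \<omega> c b a p)"
      unfolding skew(1)[of i] left[symmetric] by (simp add: sum_negf)
    also have "\<dots> = (\<Sum>b\<in>UNIV. \<Sum>a\<in>UNIV. J i ?x $ a * K j $ b * form_comp A \<omega> c a b p)"
      unfolding sum_negf[symmetric]
      by (intro sum.cong refl) (subst skew(2), simp)
    also have "\<dots> = (\<Sum>a\<in>UNIV. \<Sum>b\<in>UNIV. J i ?x $ a * K j $ b * form_comp A \<omega> c a b p)"
      by (rule sum.swap)
    finally show ?thesis .
  qed
  let ?w = "\<lambda>a b. coord_rep c' (form_comp A \<omega> c a b)"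
  have dw: "?w a b differentiable at ?x" for a b
    by (rule differentiable_change[OF c' c pc(2,1) form_comp_differentiable[OF \<omega> c pc(1)]])
  have w0: "dir_deriv v (?w a b) ?x = 0" for v a b
    unfolding dir_deriv_change[OF c' c pc(2,1) form_comp_differentiable[OF \<omega> c pc(1)]]
    by (rule dir_deriv_form_comp_zero[OF \<omega> c pc(1) const])
  have "coord_deriv c' k (form_comp A \<omega> c' i j) p
      = dir_deriv (axis k 1) (\<lambda>y. \<Sum>a\<in>UNIV. \<Sum>b\<in>UNIV. J i y $ a * J j y $ b * ?w a b y) ?x"
    unfolding coord_deriv_def
  proof (rule dir_deriv_cong[OF opO xO])
    fix y assume "y \<in> ?O"
    then obtain q where q: "y = snd c' q" "q \<in> fst c" "q \<in> fst c'" by blast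
    show "coord_rep c' (form_comp A \<omega> c' i j) y = (\<Sum>a\<in>UNIV. \<Sum>b\<in>UNIV. J i y $ a * J j y $ b * ?w a b y)"
      using form_expand[OF \<omega> coord_field_tangent[OF c' q(3), of i] coord_field_tangent[OF c' q(3), of j] c q(2)]
      by (simp add: q c' field form_comp_def[of A \<omega> c'])
  qed
  also have "\<dots> = (\<Sum>a\<in>UNIV. \<Sum>b\<in>UNIV. J i ?x $ a * J j ?x $ b * dir_deriv (axis k 1) (?w a b) ?x
      + (J i ?x $ a * dir_deriv (axis k 1) (J j) ?x $ b + dir_deriv (axis k 1) (J i) ?x $ a * J j ?x $ b) * ?w a b ?x)"
    by (intro dir_deriv_eq has_derivative_sum has_derivative_mult
        bounded_linear.has_derivative[OF bounded_linear_vec_nth] has_derivative_dir_deriv dw dJ)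
  also have "\<dots> = (\<Sum>a\<in>UNIV. \<Sum>b\<in>UNIV. K i $ a * J j ?x $ b * form_comp A \<omega> c a b p)
      + (\<Sum>a\<in>UNIV. \<Sum>b\<in>UNIV. J i ?x $ a * K j $ b * form_comp A \<omega> c a b p)"
    using c' pc by (simp add: w0 K_def sum.distrib[symmetric] algebra_simps)
  finally show ?thesis unfolding left right by simp
qed

end


section \<open>The characterisation\<close>

theorem theorem3p8:
  fixes A :: "('m::{t2_space, second_countable_topology}, real^'d) chart set"
    and \<omega> :: "('m, real^'d) bilin_field"
    and F :: "'m \<times> ('m, real^'d) tvec \<Rightarrow> real"
    and nabla :: "('m, real^'d) pb_connection"
    and n :: nat
  assumes "smooth_structure A"
    and "CARD('d) = 2 * n"
    and "symplectic_form A \<omega>"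
    and "finsler_structure A F"
    and "locally_minkowskian A F"
    and "chern_connection A F nabla"
  shows "preserves_form A nabla \<omega> \<longleftrightarrow>
    (\<forall>c c'. natural_coordinates A F c \<and> c' \<in> A \<longrightarrow>
      (\<forall>i j k.
        (\<forall>p\<in>fst c. coord_deriv c k (form_comp A \<omega> c i j) p = 0) \<and>
        (\<forall>p\<in>fst c \<inter> fst c'.
          (\<Sum>h\<in>UNIV. \<Sum>l\<in>UNIV.
             coord_deriv c h (\<lambda>q. snd c' q $ l) p
             * coord_deriv c' k (coord_deriv c' i (\<lambda>q. snd c q $ h)) p
             * form_comp A \<omega> c' l j p)
          + (\<Sum>h\<in>UNIV. \<Sum>l\<in>UNIV.
             coord_deriv c h (\<lambda>q. snd c' q $ l) p
             * coord_deriv c' k (coord_deriv c' j (\<lambda>q. snd c q $ h)) p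
             * form_comp A \<omega> c' i l p)
          = coord_deriv c' k (form_comp A \<omega> c' i j) p)))"
proof -
  interpret smooth_manifold A by unfold_locales (rule assms(1))
  have \<omega>: "two_form A \<omega>" using assms(3) unfolding symplectic_form_def by blast
  have natural_chart: "c \<in> A" if "natural_coordinates A F c" for c
    using that unfolding natural_coordinates_def by blast
  show ?thesis
    unfolding preserves_form_iff_constant[OF assms(4,6) \<omega> assms(5)]
  proof (intro iffI allI impI conjI ballI; (elim conjE)?)
    fix c c' i j k p
    assume const: "\<forall>c. natural_coordinates A F c \<longrightarrow>
        (\<forall>i j k. \<forall>p\<in>fst c. coord_deriv c k (form_comp A \<omega> c i j) p = 0)"
      and nat: "natural_coordinates A F c" and c': "c' \<in> A"
    show "coord_deriv c k (form_comp A \<omega> c i j) p = 0" if "p \<in> fst c"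
      using const nat that by blast
    assume p: "p \<in> fst c \<inter> fst c'"
    show "(\<Sum>h\<in>UNIV. \<Sum>l\<in>UNIV.
             coord_deriv c h (\<lambda>q. snd c' q $ l) p
             * coord_deriv c' k (coord_deriv c' i (\<lambda>q. snd c q $ h)) p
             * form_comp A \<omega> c' l j p)
          + (\<Sum>h\<in>UNIV. \<Sum>l\<in>UNIV.
             coord_deriv c h (\<lambda>q. snd c' q $ l) p
             * coord_deriv c' k (coord_deriv c' j (\<lambda>q. snd c q $ h)) p
             * form_comp A \<omega> c' i l p)
          = coord_deriv c' k (form_comp A \<omega> c' i j) p"
      by (rule constant_form_change[OF \<omega> natural_chart[OF nat] c' p]) (use const nat p in blast)
  qed (use natural_chart in blast)
qed

end
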